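(* Let $X$ be a metric space which coarsely embeds into a Hilbert space, and let $G$ be a finite group acting on $X$ by isometries. Let $X/G$ be the quotient (orbit space) of $X$ by the action of $G$, with the metric $d([x],[y]) = \inf_{g\in G} d(x, g\cdot y)$. Then $X/G$ coarsely embeds into a Hilbert space.
   Context: A map $f: X\to Y$ between metric spaces is a coarse embedding if there are non-decreasing functions $\rho_-,\rho_+:[0,\infty)\to[0,\infty)$ with $\lim_{t\to\infty}\rho_-(t)=\infty$ such that $\rho_-(d(x,x'))\le d(f(x),f(x'))\le \rho_+(d(x,x'))$ for all $x,x'\in X$. A metric space coarsely embeds into a Hilbert space if there exist a (real) Hilbert space $H$ and a coarse embedding $X\to H$. For a finite group $G$ acting on $X$ by isometries, $[x]$ denotes the orbit of $x$, and the metric on the set of orbits $X/G$ is $d([x],[y]) = \inf_{x'\in[x],\,y'\in[y]} d(x',y') = \inf_{g\in G} d(x,g\cdot y)$. *)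

theory Defs
  imports
    "HOL-Analysis.Analysis"
    "HOL-Algebra.Group_Action"
    "HOL-Library.Function_Algebras"
begin

section \<open>Real Hilbert spaces on carrier sets\<close>

text \<open>
  A Hilbert space is given by a linear subspace of an ambient real vector space type together with
  an inner product on that subspace. Working with carriers makes it possible to quantify
  existentially over Hilbert spaces inside a formula. The ambient type carries no topology; the
  metric is the one induced by the inner product.
\<close>

text \<open>
  The case distinction is needed since the locale \<^locale>\<open>Metric_space\<close> asks for nonnegativity and
  symmetry of the distance outside the carrier as well.
\<close>

definition ip_dist :: "'v::real_vector set \<Rightarrow> ('v \<Rightarrow> 'v \<Rightarrow> real) \<Rightarrow> 'v \<Rightarrow> 'v \<Rightarrow> real"
  where "ip_dist H ip x y = (if x \<in> H \<and> y \<in> H then sqrt (ip (x - y) (x - y)) else 0)"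

locale inner_product_space =
  fixes H :: "'v::real_vector set" and ip :: "'v \<Rightarrow> 'v \<Rightarrow> real"
  assumes subspace: "subspace H"
    and ip_commute: "\<lbrakk>x \<in> H; y \<in> H\<rbrakk> \<Longrightarrow> ip x y = ip y x"
    and ip_add_left: "\<lbrakk>x \<in> H; y \<in> H; z \<in> H\<rbrakk> \<Longrightarrow> ip (x + y) z = ip x z + ip y z"
    and ip_scale_left: "\<lbrakk>x \<in> H; y \<in> H\<rbrakk> \<Longrightarrow> ip (r *\<^sub>R x) y = r * ip x y"
    and ip_nonneg: "x \<in> H \<Longrightarrow> 0 \<le> ip x x"
    and ip_definite: "\<lbrakk>x \<in> H; ip x x = 0\<rbrakk> \<Longrightarrow> x = 0"

locale hilbert_space = inner_product_space +
  assumes complete: "Metric_space.mcomplete H (ip_dist H ip)"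

context inner_product_space
begin

lemma mem [simp, intro]:
  "0 \<in> H" "\<lbrakk>x \<in> H; y \<in> H\<rbrakk> \<Longrightarrow> x + y \<in> H" "\<lbrakk>x \<in> H; y \<in> H\<rbrakk> \<Longrightarrow> x - y \<in> H" "x \<in> H \<Longrightarrow> r *\<^sub>R x \<in> H"
  using subspace by (simp_all add: subspace_0 subspace_add subspace_diff subspace_scale)

lemma ip_diff_left: "\<lbrakk>x \<in> H; y \<in> H; z \<in> H\<rbrakk> \<Longrightarrow> ip (x - y) z = ip x z - ip y z"
  using ip_add_left[of "x - y" y z] by simp

lemma ip_zero_left: "y \<in> H \<Longrightarrow> ip 0 y = 0"
  using ip_scale_left[of 0 y 0] by simp

lemma ip_add_right: "\<lbrakk>x \<in> H; y \<in> H; z \<in> H\<rbrakk> \<Longrightarrow> ip z (x + y) = ip z x + ip z y"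
  by (simp add: ip_add_left ip_commute[of z])

lemma ip_diff_right: "\<lbrakk>x \<in> H; y \<in> H; z \<in> H\<rbrakk> \<Longrightarrow> ip z (x - y) = ip z x - ip z y"
  by (simp add: ip_diff_left ip_commute[of z])

lemma ip_scale_right: "\<lbrakk>x \<in> H; y \<in> H\<rbrakk> \<Longrightarrow> ip x (r *\<^sub>R y) = r * ip x y"
  by (simp add: ip_scale_left ip_commute[of x])

lemma Cauchy_Schwarz:
  assumes "x \<in> H" "y \<in> H"
  shows "\<bar>ip x y\<bar> \<le> sqrt (ip x x) * sqrt (ip y y)"
proof (cases "ip y y = 0")
  case True
  then have "y = 0" using ip_definite assms by blast
  then show ?thesis using assms ip_commute[of x 0] by (simp add: ip_zero_left)
next
  case False
  then have pos: "0 < ip y y" using ip_nonneg[OF assms(2)] by simp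
  define r where "r = ip x y / ip y y"
  have "0 \<le> ip (x - r *\<^sub>R y) (x - r *\<^sub>R y)"
    using assms by (intro ip_nonneg) simp
  also have "\<dots> = ip x x - r * ip x y - r * (ip x y - r * ip y y)"
    using assms ip_commute[of y x]
    by (simp add: ip_diff_left ip_diff_right ip_scale_left ip_scale_right)
  also have "\<dots> = ip x x - (ip x y)\<^sup>2 / ip y y"
    using pos by (simp add: r_def power2_eq_square)
  finally have "(ip x y)\<^sup>2 \<le> ip x x * ip y y"
    using pos by (simp add: field_simps)
  then have "sqrt ((ip x y)\<^sup>2) \<le> sqrt (ip x x * ip y y)"
    by (rule real_sqrt_le_mono)
  then show ?thesis by (simp add: real_sqrt_mult)
qed

lemma norm_triangle:
  assumes "x \<in> H" "y \<in> H"
  shows "sqrt (ip (x + y) (x + y)) \<le> sqrt (ip x x) + sqrt (ip y y)"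
proof (rule real_le_lsqrt)
  have "ip (x + y) (x + y) = ip x x + 2 * ip x y + ip y y"
    using assms ip_commute[of y x] by (simp add: ip_add_left ip_add_right)
  also have "\<dots> \<le> ip x x + 2 * (sqrt (ip x x) * sqrt (ip y y)) + ip y y"
    using Cauchy_Schwarz[OF assms] by linarith
  also have "\<dots> = (sqrt (ip x x) + sqrt (ip y y))\<^sup>2"
    using assms by (simp add: power2_sum ip_nonneg)
  finally show "ip (x + y) (x + y) \<le> (sqrt (ip x x) + sqrt (ip y y))\<^sup>2" .
qed (use assms in \<open>simp_all add: ip_nonneg\<close>)

sublocale metric: Metric_space H "ip_dist H ip"
proof
  fix x y z
  show "0 \<le> ip_dist H ip x y"
    by (simp add: ip_dist_def ip_nonneg)
  have "ip (x - y) (x - y) = ip (y - x) (y - x)" if "x \<in> H" "y \<in> H"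
    using that by (simp add: ip_diff_left ip_diff_right)
  then show "ip_dist H ip x y = ip_dist H ip y x"
    by (auto simp: ip_dist_def)
  show "ip_dist H ip x y = 0 \<longleftrightarrow> x = y" if "x \<in> H" "y \<in> H"
    using that ip_definite[of "x - y"] by (auto simp: ip_dist_def ip_zero_left)
  show "ip_dist H ip x z \<le> ip_dist H ip x y + ip_dist H ip y z" if "x \<in> H" "y \<in> H" "z \<in> H"
    using that norm_triangle[of "x - y" "y - z"] by (simp add: ip_dist_def)
qed

end

lemma hilbert_space_UNIV: "hilbert_space (UNIV :: 'h::{real_inner, complete_space} set) inner"
proof -
  interpret inner_product_space "UNIV :: 'h set" inner
    by unfold_locales (auto simp: inner_add_left inner_add_right inner_commute)
  have "ip_dist UNIV inner = (dist :: 'h \<Rightarrow> _)"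
    by (auto simp: ip_dist_def dist_norm norm_eq_sqrt_inner fun_eq_iff)
  then show ?thesis
    by unfold_locales (simp add: complete_UNIV)
qed


section \<open>Coarse embeddings\<close>

definition coarse_embedding ::
    "'a set \<Rightarrow> ('a \<Rightarrow> 'a \<Rightarrow> real) \<Rightarrow> 'b set \<Rightarrow> ('b \<Rightarrow> 'b \<Rightarrow> real) \<Rightarrow> ('a \<Rightarrow> 'b) \<Rightarrow> bool"
  where "coarse_embedding M d N e f \<longleftrightarrow>
    f \<in> M \<rightarrow> N \<and>
    (\<exists>\<rho>\<^sub>1 \<rho>\<^sub>2 :: real \<Rightarrow> real.
      \<rho>\<^sub>1 \<in> {0..} \<rightarrow> {0..} \<and> \<rho>\<^sub>2 \<in> {0..} \<rightarrow> {0..} \<and>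
      mono_on {0..} \<rho>\<^sub>1 \<and> mono_on {0..} \<rho>\<^sub>2 \<and>
      filterlim \<rho>\<^sub>1 at_top at_top \<and>
      (\<forall>x\<in>M. \<forall>y\<in>M. \<rho>\<^sub>1 (d x y) \<le> e (f x) (f y) \<and> e (f x) (f y) \<le> \<rho>\<^sub>2 (d x y)))"

text \<open>
  The type argument only says in which ambient vector space type the Hilbert space is to be found.
  Lemma \<open>coarsely_embeds_into_Hilbert_fun\<close> below shows that the choice
  \<^typ>\<open>'a \<Rightarrow> real\<close> for a metric space with points in \<^typ>\<open>'a\<close> is no restriction.
\<close>

definition coarsely_embeds_into_Hilbert ::
    "'v::real_vector itself \<Rightarrow> 'a set \<Rightarrow> ('a \<Rightarrow> 'a \<Rightarrow> real) \<Rightarrow> bool"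
  where "coarsely_embeds_into_Hilbert TYPE('v) M d \<longleftrightarrow>
    (\<exists>(H :: 'v set) ip f. hilbert_space H ip \<and> coarse_embedding M d H (ip_dist H ip) f)"

instantiation "fun" :: (type, real_vector) real_vector
begin

definition scaleR_fun :: "real \<Rightarrow> ('a \<Rightarrow> 'b) \<Rightarrow> 'a \<Rightarrow> 'b"
  where "scaleR_fun r f = (\<lambda>x. r *\<^sub>R f x)"

instance
  by standard (simp_all add: scaleR_fun_def fun_eq_iff algebra_simps)

end

lemma coarsely_embeds_into_Hilbert_fun:
  fixes M :: "'a set"
  assumes "coarsely_embeds_into_Hilbert TYPE('v::real_vector) M d"
  shows "coarsely_embeds_into_Hilbert TYPE('a \<Rightarrow> real) M d"
proof -
  obtain H :: "'v set" and ip f where hs: "hilbert_space H ip"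
    and ce: "coarse_embedding M d H (ip_dist H ip) f"
    using assms unfolding coarsely_embeds_into_Hilbert_def by blast
  interpret hilbert_space H ip by (fact hs)
  have fH: "f s \<in> H" if "s \<in> M" for s
    using ce that by (auto simp: coarse_embedding_def)
  define s0 where "s0 = (SOME s. s \<in> M)"
  have s0: "s0 \<in> M" if "s \<in> M" for s
    unfolding s0_def using that by (rule someI)
  define u where "u s = (if s \<in> M then f s - f s0 else 0)" for s
  have uH [simp]: "u s \<in> H" for s
    using fH s0 by (auto simp: u_def)
  define W where "W = {w \<in> H. \<forall>v\<in>H. (\<forall>s. ip v (u s) = 0) \<longrightarrow> ip w v = 0}"
  have WH: "w \<in> H" if "w \<in> W" for w
    using that by (simp add: W_def)
  have W: "subspace W"
    unfolding W_def subspace_def by (auto simp: ip_zero_left ip_add_left ip_scale_left)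
  have Wdiff: "x - y \<in> W" if "x \<in> W" "y \<in> W" for x y
    using W that by (rule subspace_diff)
  have uW: "u s \<in> W" for s
    by (auto simp: W_def ip_commute[of "u s"])
  define T where "T w = (\<lambda>s. ip w (u s))" for w
  have T_add: "T (x + y) = T x + T y" if "x \<in> W" "y \<in> W" for x y
    using that by (auto simp: T_def WH ip_add_left)
  have T_scale: "T (r *\<^sub>R x) = r *\<^sub>R T x" if "x \<in> W" for x r
    using that by (auto simp: T_def WH ip_scale_left scaleR_fun_def)
  have T_diff: "T (x - y) = T x - T y" if "x \<in> W" "y \<in> W" for x y
    using that by (auto simp: T_def WH ip_diff_left)
  have T_inj: "inj_on T W"
  proof (rule inj_onI)
    fix x y assume xy: "x \<in> W" "y \<in> W" "T x = T y"
    then have "T (x - y) = 0" by (simp add: T_diff)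
    then have "\<forall>s. ip (x - y) (u s) = 0" by (simp add: T_def fun_eq_iff)
    then have "ip (x - y) (x - y) = 0"
      using Wdiff[OF xy(1,2)] by (auto simp: W_def)
    then show "x = y"
      using ip_definite[of "x - y"] xy WH by simp
  qed
  define K where "K = T ` W"
  define jp where "jp a b = ip (inv_into W T a) (inv_into W T b)" for a b
  have jp: "jp (T x) (T y) = ip x y" if "x \<in> W" "y \<in> W" for x y
    using that by (simp add: jp_def inv_into_f_f[OF T_inj])
  have Wadd: "x + y \<in> W" "r *\<^sub>R x \<in> W" if "x \<in> W" "y \<in> W" for x y r
    using W that by (auto simp: subspace_add subspace_scale)
  have T0: "T 0 = 0"
    by (auto simp: T_def ip_zero_left)
  interpret K: inner_product_space K jp
  proof
    show "subspace K"
      unfolding subspace_def K_def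
    proof (intro conjI ballI allI)
      show "0 \<in> T ` W" using T0 subspace_0[OF W] by (metis imageI)
    next
      fix a b assume "a \<in> T ` W" "b \<in> T ` W"
      then show "a + b \<in> T ` W" using Wadd T_add by (smt (verit) image_iff)
    next
      fix r a assume "a \<in> T ` W"
      then show "r *\<^sub>R a \<in> T ` W" using Wadd T_scale by (smt (verit) image_iff)
    qed
  next
    fix a b assume "a \<in> K" "b \<in> K"
    then show "jp a b = jp b a" by (auto simp: K_def jp) (meson WH ip_commute)
  next
    fix a b c assume "a \<in> K" "b \<in> K" "c \<in> K"
    then obtain x y z where "x \<in> W" "y \<in> W" "z \<in> W" "a = T x" "b = T y" "c = T z"
      by (auto simp: K_def)
    then show "jp (a + b) c = jp a c + jp b c"
      by (simp add: T_add[symmetric] jp Wadd WH ip_add_left)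
  next
    fix a b r assume "a \<in> K" "b \<in> K"
    then obtain x y where "x \<in> W" "y \<in> W" "a = T x" "b = T y"
      by (auto simp: K_def)
    then show "jp (r *\<^sub>R a) b = r * jp a b"
      by (simp add: T_scale[symmetric] jp Wadd(2)[of x x] WH ip_scale_left)
  next
    fix a assume "a \<in> K"
    then show "0 \<le> jp a a" by (auto simp: K_def jp WH ip_nonneg)
  next
    fix a assume "a \<in> K" "jp a a = 0"
    then obtain x where x: "x \<in> W" "a = T x" "ip x x = 0"
      by (auto simp: K_def jp)
    then have "x = 0" using ip_definite WH by blast
    then show "a = 0" using T0 x by simp
  qed
  have dist_T: "ip_dist K jp (T x) (T y) = ip_dist H ip x y" if "x \<in> W" "y \<in> W" for x y
    using that by (simp add: ip_dist_def T_diff[symmetric] jp Wdiff WH) (simp add: K_def)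
  have "K.metric.mcomplete"
    unfolding K.metric.mcomplete_def
  proof (intro allI impI)
    fix \<sigma> assume \<sigma>: "K.metric.MCauchy \<sigma>"
    then have "range \<sigma> \<subseteq> T ` W"
      unfolding K.metric.MCauchy_def by (simp add: K_def)
    then have "\<forall>n. \<exists>w. w \<in> W \<and> \<sigma> n = T w"
      by blast
    then obtain w where w: "\<And>n. w n \<in> W" "\<And>n. \<sigma> n = T (w n)"
      by metis
    have "metric.MCauchy w"
      using \<sigma> w WH by (auto simp: K.metric.MCauchy_def metric.MCauchy_def dist_T)
    then obtain l where "limitin metric.mtopology w l sequentially"
      using complete by (auto simp: metric.mcomplete_def)
    then have l: "l \<in> H" and lim: "\<And>\<epsilon>. \<epsilon> > 0 \<Longrightarrow> \<exists>N. \<forall>n\<ge>N. ip_dist H ip (w n) l < \<epsilon>"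
      unfolding metric.limit_metric_sequentially by blast+
    have "l \<in> W"
      unfolding W_def
    proof (intro CollectI conjI ballI impI l)
      fix v assume v: "v \<in> H" "\<forall>s. ip v (u s) = 0"
      show "ip l v = 0"
      proof (rule ccontr)
        assume neq: "ip l v \<noteq> 0"
        define c where "c = sqrt (ip v v) + 1"
        have c: "c > 0" using v by (simp add: c_def ip_nonneg add_nonneg_pos)
        then obtain n where n: "ip_dist H ip (w n) l < \<bar>ip l v\<bar> / c"
          using lim[of "\<bar>ip l v\<bar> / c"] neq by auto
        have "ip (w n) v = 0" using w(1)[of n] v by (auto simp: W_def)
        then have "\<bar>ip l v\<bar> = \<bar>ip (w n - l) v\<bar>"
          using v l w(1) WH by (simp add: ip_diff_left)
        also have "\<dots> \<le> ip_dist H ip (w n) l * sqrt (ip v v)"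
          using Cauchy_Schwarz[of "w n - l" v] v l WH[OF w(1)] by (simp add: ip_dist_def)
        also have "\<dots> \<le> ip_dist H ip (w n) l * c"
          by (intro mult_left_mono) (simp_all add: c_def)
        also have "\<dots> < \<bar>ip l v\<bar>"
          using n c by (simp add: field_simps)
        finally show False by simp
      qed
    qed
    then have "limitin K.metric.mtopology \<sigma> (T l) sequentially"
      using lim w by (simp add: K.metric.limit_metric_sequentially dist_T) (simp add: K_def)
    then show "\<exists>x. limitin K.metric.mtopology \<sigma> x sequentially" by blast
  qed
  then have "hilbert_space K jp"
    by unfold_locales
  moreover have "coarse_embedding M d K (ip_dist K jp) (\<lambda>s. T (u s))"
  proof -
    have "ip_dist K jp (T (u s)) (T (u t)) = ip_dist H ip (f s) (f t)" if "s \<in> M" "t \<in> M" for s t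
      using that by (simp add: dist_T uW) (simp add: ip_dist_def u_def fH s0)
    then show ?thesis
      using ce uW by (auto simp: coarse_embedding_def K_def)
  qed
  ultimately show ?thesis
    unfolding coarsely_embeds_into_Hilbert_def by blast
qed


section \<open>Isometric actions and the orbit space\<close>

locale isometric_group_action = group_action G M \<phi> + Metric_space M d
  for G (structure) and M \<phi> and d +
  assumes isometry: "\<lbrakk>g \<in> carrier G; x \<in> M; y \<in> M\<rbrakk> \<Longrightarrow> d (\<phi> g x) (\<phi> g y) = d x y"

text \<open>
  The value \<open>0\<close> for empty sets follows the convention of \<^const>\<open>setdist\<close>; orbits are never empty.
\<close>

definition orbit_dist :: "('a \<Rightarrow> 'a \<Rightarrow> real) \<Rightarrow> 'a set \<Rightarrow> 'a set \<Rightarrow> real"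
  where "orbit_dist d A B = (if A = {} \<or> B = {} then 0 else Inf {d x y |x y. x \<in> A \<and> y \<in> B})"

context isometric_group_action
begin

lemma action_mem: "\<lbrakk>g \<in> carrier G; x \<in> M\<rbrakk> \<Longrightarrow> \<phi> g x \<in> M"
  using element_image by blast

lemma orbit_nonempty: "x \<in> M \<Longrightarrow> orbit G \<phi> x \<noteq> {}"
  using orbit_refl by blast

lemma orbit_dist_eq:
  assumes "x \<in> M" "y \<in> M"
  shows "orbit_dist d (orbit G \<phi> x) (orbit G \<phi> y) = (INF g\<in>carrier G. d x (\<phi> g y))"
proof -
  interpret group G using group_hom group_hom.axioms(1) by auto
  have "{d a b |a b. a \<in> orbit G \<phi> x \<and> b \<in> orbit G \<phi> y} = (\<lambda>g. d x (\<phi> g y)) ` carrier G"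
    (is "?L = ?R")
  proof
    show "?R \<subseteq> ?L"
      using orbit_refl[OF assms(1)] by (auto simp: orbit_def)
    show "?L \<subseteq> ?R"
    proof
      fix r assume "r \<in> ?L"
      then obtain g h where gh: "g \<in> carrier G" "h \<in> carrier G" "r = d (\<phi> g x) (\<phi> h y)"
        by (auto simp: orbit_def)
      have "\<phi> (inv g) (\<phi> g x) = x"
        using orbit_sym_aux gh(1) assms(1) by blast
      then have "r = d x (\<phi> (inv g \<otimes> h) y)"
        using isometry[of "inv g" "\<phi> g x" "\<phi> h y"] gh assms
        by (simp add: action_mem composition_rule)
      then show "r \<in> ?R" using gh by blast
    qed
  qed
  then show ?thesis
    using orbit_nonempty assms by (simp add: orbit_dist_def)
qed

lemma Metric_space_orbits:
  assumes fin: "finite (carrier G)"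
  shows "Metric_space (orbits G M \<phi>) (orbit_dist d)"
proof -
  interpret grp: group G using group_hom group_hom.axioms(1) by auto
  have ne: "(\<lambda>g. d x (\<phi> g y)) ` carrier G \<noteq> {}" for x y
    using grp.one_closed by blast
  have attained: "\<exists>g\<in>carrier G. orbit_dist d (orbit G \<phi> x) (orbit G \<phi> y) = d x (\<phi> g y)"
    if "x \<in> M" "y \<in> M" for x y
  proof -
    have "(INF g\<in>carrier G. d x (\<phi> g y)) \<in> (\<lambda>g. d x (\<phi> g y)) ` carrier G"
      using fin ne by (metis cInf_eq_Min finite_imageI Min_in)
    then show ?thesis using that by (auto simp: orbit_dist_eq)
  qed
  have le: "orbit_dist d (orbit G \<phi> x) (orbit G \<phi> y) \<le> d x (\<phi> g y)"
    if "x \<in> M" "y \<in> M" "g \<in> carrier G" for x y g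
    unfolding orbit_dist_eq[OF that(1,2)] using fin that by (intro cINF_lower) auto
  show ?thesis
  proof
    fix A B
    show "0 \<le> orbit_dist d A B"
      unfolding orbit_dist_def by (auto intro!: cInf_greatest)
    have "{d x y |x y. x \<in> A \<and> y \<in> B} = {d x y |x y. x \<in> B \<and> y \<in> A}"
      using commute by metis
    then show "orbit_dist d A B = orbit_dist d B A"
      by (auto simp: orbit_dist_def)
  next
    fix A B assume "A \<in> orbits G M \<phi>" "B \<in> orbits G M \<phi>"
    then obtain x y where xy: "x \<in> M" "y \<in> M" "A = orbit G \<phi> x" "B = orbit G \<phi> y"
      by (auto simp: orbits_def)
    show "orbit_dist d A B = 0 \<longleftrightarrow> A = B"
    proof
      assume "orbit_dist d A B = 0"
      then obtain g where g: "g \<in> carrier G" "x = \<phi> g y"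
        using attained[OF xy(1,2)] xy action_mem by force
      then have "x \<in> orbit G \<phi> y" by (auto simp: orbit_def)
      then have "x \<in> A \<inter> B" using orbit_refl xy by blast
      then show "A = B"
        using disjoint_union \<open>A \<in> _\<close> \<open>B \<in> _\<close> by blast
    next
      assume "A = B"
      then have "orbit_dist d A B \<le> d x (\<phi> \<one> x)"
        using le[of x x \<one>] xy by simp
      moreover have "\<phi> \<one> x = x"
        using id_eq_one xy by (metis restrict_apply')
      moreover have "0 \<le> orbit_dist d A B"
        unfolding orbit_dist_def by (auto intro!: cInf_greatest)
      ultimately show "orbit_dist d A B = 0" using xy by simp
    qed
  next
    fix A B C assume "A \<in> orbits G M \<phi>" "B \<in> orbits G M \<phi>" "C \<in> orbits G M \<phi>"
    then obtain x y z where xyz: "x \<in> M" "y \<in> M" "z \<in> M"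
      and ABC: "A = orbit G \<phi> x" "B = orbit G \<phi> y" "C = orbit G \<phi> z"
      by (auto simp: orbits_def)
    obtain g where g: "g \<in> carrier G" "orbit_dist d A B = d x (\<phi> g y)"
      using attained xyz ABC by blast
    obtain h where h: "h \<in> carrier G" "orbit_dist d B C = d y (\<phi> h z)"
      using attained xyz ABC by blast
    have "orbit_dist d A C \<le> d x (\<phi> (g \<otimes> h) z)"
      using le[of x z "g \<otimes> h"] xyz ABC g h by simp
    also have "\<dots> \<le> d x (\<phi> g y) + d (\<phi> g y) (\<phi> g (\<phi> h z))"
      using xyz g h by (simp add: composition_rule action_mem triangle)
    also have "\<dots> = orbit_dist d A B + orbit_dist d B C"
      using xyz g h by (simp add: isometry action_mem)
    finally show "orbit_dist d A C \<le> orbit_dist d A B + orbit_dist d B C" .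
  qed
qed

end

end

theory Submission
  imports Defs "HOL-Real_Asymp.Real_Asymp"
begin

text \<open>
  Let \<open>f\<close> be a coarse embedding of \<open>X\<close> into a Hilbert space. The Gaussian kernel
  \<open>k\<^sub>n(a, b) = exp (- 4\<^sup>-\<^sup>n \<parallel>f a - f b\<parallel>\<^sup>2)\<close> is the Gram kernel of a map \<open>\<Phi>\<^sub>n\<close> into a Hilbert space.
  Replacing \<open>\<Phi>\<^sub>n(x)\<close> by the sum of \<open>\<Phi>\<^sub>n\<close> over the translates of \<open>x\<close> gives a map on \<open>X/G\<close>. Since
  \<open>k\<^sub>n \<ge> 0\<close>, this summation does not destroy the norm: it is at least \<open>sqrt m\<close>, where \<open>m = |G|\<close>. So
  the images of two orbits at large distance, being almost orthogonal, have squared distance at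
  least \<open>m\<close>. For nearby orbits the squared distance \<open>N\<^sub>n\<close> is at most a constant times \<open>2\<^sup>-\<^sup>n\<close>, because
  \<open>s \<mapsto> exp (- s\<^sup>2)\<close> is Lipschitz. Hence \<open>N = \<Sum>n. N\<^sub>n\<close> converges, is bounded above in terms of the
  distance of the orbits, and tends to infinity with it. As \<open>N\<close> is conditionally negative definite,
  it is the square of a Hilbert space distance by Schoenberg's theorem.
\<close>

section \<open>Completion of semi-inner product spaces\<close>

text \<open>Definiteness is left out because both forms used below can be degenerate: the form built
  from a kernel of negative type, and the limit form on Cauchy sequences, which vanishes on null
  sequences.\<close>

locale semi_inner_product_space =
  fixes V :: "'v::real_vector set" and B :: "'v \<Rightarrow> 'v \<Rightarrow> real"
  assumes subspace: "subspace V"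
    and commute: "\<lbrakk>x \<in> V; y \<in> V\<rbrakk> \<Longrightarrow> B x y = B y x"
    and add_left: "\<lbrakk>x \<in> V; y \<in> V; z \<in> V\<rbrakk> \<Longrightarrow> B (x + y) z = B x z + B y z"
    and scale_left: "\<lbrakk>x \<in> V; y \<in> V\<rbrakk> \<Longrightarrow> B (r *\<^sub>R x) y = r * B x y"
    and nonneg: "x \<in> V \<Longrightarrow> 0 \<le> B x x"
begin

lemma mem [simp, intro]:
  "0 \<in> V" "\<lbrakk>x \<in> V; y \<in> V\<rbrakk> \<Longrightarrow> x + y \<in> V" "\<lbrakk>x \<in> V; y \<in> V\<rbrakk> \<Longrightarrow> x - y \<in> V" "x \<in> V \<Longrightarrow> r *\<^sub>R x \<in> V"
  using subspace by (simp_all add: subspace_0 subspace_add subspace_diff subspace_scale)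

lemma diff_left: "\<lbrakk>x \<in> V; y \<in> V; z \<in> V\<rbrakk> \<Longrightarrow> B (x - y) z = B x z - B y z"
  using add_left[of "x - y" y z] by simp

lemma add_right: "\<lbrakk>x \<in> V; y \<in> V; z \<in> V\<rbrakk> \<Longrightarrow> B z (x + y) = B z x + B z y"
  by (simp add: add_left commute[of z])

lemma diff_right: "\<lbrakk>x \<in> V; y \<in> V; z \<in> V\<rbrakk> \<Longrightarrow> B z (x - y) = B z x - B z y"
  by (simp add: diff_left commute[of z])

lemma scale_right: "\<lbrakk>x \<in> V; y \<in> V\<rbrakk> \<Longrightarrow> B x (r *\<^sub>R y) = r * B x y"
  by (simp add: scale_left commute[of x])

lemma zero_left: "y \<in> V \<Longrightarrow> B 0 y = 0"
  using scale_left[of 0 y 0] by simp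

definition seminorm :: "'v \<Rightarrow> real"
  where "seminorm x = sqrt (B x x)"

lemma seminorm_nonneg: "x \<in> V \<Longrightarrow> 0 \<le> seminorm x"
  by (simp add: seminorm_def nonneg)

lemma seminorm_sq: "x \<in> V \<Longrightarrow> (seminorm x)\<^sup>2 = B x x"
  by (simp add: seminorm_def nonneg)

lemma Cauchy_Schwarz:
  assumes "x \<in> V" "y \<in> V"
  shows "\<bar>B x y\<bar> \<le> seminorm x * seminorm y"
proof -
  have quad: "0 \<le> B x x - 2 * r * B x y + r\<^sup>2 * B y y" for r
  proof -
    have "0 \<le> B (x - r *\<^sub>R y) (x - r *\<^sub>R y)"
      using assms by (intro nonneg) simp
    also have "\<dots> = B x x - 2 * r * B x y + r\<^sup>2 * B y y"
      using assms commute[of y x]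
      by (simp add: diff_left diff_right scale_left scale_right power2_eq_square algebra_simps)
    finally show ?thesis .
  qed
  show ?thesis
  proof (cases "B y y = 0")
    case True
    have "B x y = 0"
    proof (rule ccontr)
      assume "B x y \<noteq> 0"
      \<comment> \<open>For \<open>B y y = 0\<close> the quadratic is linear in \<open>r\<close>,
        and this choice of \<open>r\<close> makes its value -1.\<close>
      then show False
        using quad[of "(B x x + 1) / (2 * B x y)"] True nonneg[OF assms(1)] by simp
    qed
    then show ?thesis using assms by (simp add: seminorm_nonneg)
  next
    case False
    then have "0 < B y y" using nonneg[OF assms(2)] by simp
    then have "(B x y)\<^sup>2 \<le> B x x * B y y"
      using quad[of "B x y / B y y"] by (simp add: power2_eq_square field_simps)
    then have "sqrt ((B x y)\<^sup>2) \<le> sqrt (B x x * B y y)"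
      by (rule real_sqrt_le_mono)
    then show ?thesis by (simp add: real_sqrt_mult seminorm_def)
  qed
qed

lemma seminorm_triangle:
  assumes "x \<in> V" "y \<in> V"
  shows "seminorm (x + y) \<le> seminorm x + seminorm y"
proof (rule power2_le_imp_le)
  have "(seminorm (x + y))\<^sup>2 = (seminorm x)\<^sup>2 + 2 * B x y + (seminorm y)\<^sup>2"
    using assms commute[of y x] by (simp add: seminorm_sq add_left add_right)
  also have "\<dots> \<le> (seminorm x + seminorm y)\<^sup>2"
    using Cauchy_Schwarz[OF assms] by (simp add: power2_sum)
  finally show "(seminorm (x + y))\<^sup>2 \<le> (seminorm x + seminorm y)\<^sup>2" .
qed (use assms in \<open>simp add: seminorm_nonneg\<close>)

lemma seminorm_scale: "x \<in> V \<Longrightarrow> seminorm (r *\<^sub>R x) = \<bar>r\<bar> * seminorm x"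
  by (simp add: seminorm_def scale_left scale_right real_sqrt_mult flip: mult.assoc)

lemma seminorm_minus_commute: "\<lbrakk>x \<in> V; y \<in> V\<rbrakk> \<Longrightarrow> seminorm (x - y) = seminorm (y - x)"
  by (simp add: seminorm_def diff_left diff_right)

lemma seminorm_triangle_diff:
  "\<lbrakk>x \<in> V; y \<in> V; z \<in> V\<rbrakk> \<Longrightarrow> seminorm (x - z) \<le> seminorm (x - y) + seminorm (y - z)"
  using seminorm_triangle[of "x - y" "y - z"] by simp

lemma seminorm_reverse_triangle:
  assumes "x \<in> V" "y \<in> V"
  shows "\<bar>seminorm x - seminorm y\<bar> \<le> seminorm (x - y)"
  using seminorm_triangle[of "x - y" y] seminorm_triangle[of "y - x" x]
    seminorm_minus_commute[of x y] assms by simp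

section \<open>Quotient by null vectors, and Cauchy sequences\<close>

definition Cauchy_seqs :: "(nat \<Rightarrow> 'v) set"
  where "Cauchy_seqs = {c. (\<forall>n. c n \<in> V) \<and>
    (\<forall>e>0. \<exists>N. \<forall>m\<ge>N. \<forall>n\<ge>N. seminorm (c m - c n) < e)}"

text \<open>Null vectors are divided out by sending \<open>x\<close> to the functional
  \<open>B x\<close> on \<open>V\<close>: by Cauchy-Schwarz it is zero exactly for null vectors. The
  space of these functionals inherits the form, and completeness passes over since the map is
  isometric for the seminorm.\<close>

lemma quotient_Hilbert_space:
  assumes complete: "\<And>c. c \<in> Cauchy_seqs \<Longrightarrow> \<exists>l\<in>V. (\<lambda>n. seminorm (c n - l)) \<longlonglongrightarrow> 0"
  obtains H :: "('v \<Rightarrow> real) set" and ip T where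
    "hilbert_space H ip" "T \<in> V \<rightarrow> H"
    "\<And>x y. \<lbrakk>x \<in> V; y \<in> V\<rbrakk> \<Longrightarrow> ip_dist H ip (T x) (T y) = seminorm (x - y)"
proof -
  \<comment> \<open>The value 0 outside \<open>V\<close> keeps \<open>T\<close> linear, as the
    locale says nothing about \<open>B\<close> there.\<close>
  define T where "T x = (\<lambda>y. if y \<in> V then B x y else 0)" for x
  have T_add: "T (x + y) = T x + T y" if "x \<in> V" "y \<in> V" for x y
    using that by (auto simp: T_def add_left)
  have T_scale: "T (r *\<^sub>R x) = r *\<^sub>R T x" if "x \<in> V" for x r
    using that by (auto simp: T_def scale_left scaleR_fun_def)
  have T_diff: "T (x - y) = T x - T y" if "x \<in> V" "y \<in> V" for x y
    using that by (auto simp: T_def diff_left)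
  have T0: "T 0 = 0"
    by (auto simp: T_def zero_left)
  define H where "H = T ` V"
  \<comment> \<open>The chosen preimages may differ from the original vectors, but equal images
    under \<open>T\<close> mean equal pairings with all of \<open>V\<close>, so the value does not
    depend on the choice.\<close>
  define ip where "ip a b = B (inv_into V T a) (inv_into V T b)" for a b
  have ip: "ip (T x) (T y) = B x y" if "x \<in> V" "y \<in> V" for x y
  proof -
    define x' y' where "x' = inv_into V T (T x)" and "y' = inv_into V T (T y)"
    have x': "x' \<in> V" "T x' = T x" and y': "y' \<in> V" "T y' = T y"
      using that by (auto simp: x'_def y'_def inv_into_into f_inv_into_f)
    have "B x' y' = B x y'"
      using fun_cong[OF x'(2), of y'] y' by (simp add: T_def)
    also have "\<dots> = B x y"
      using fun_cong[OF y'(2), of x] that y' commute[of x] by (simp add: T_def)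
    finally show ?thesis by (simp add: ip_def x'_def y'_def)
  qed
  interpret H: inner_product_space H ip
  proof
    show "subspace H"
      unfolding subspace_def H_def
    proof (intro conjI ballI allI)
      show "0 \<in> T ` V" using T0 by (metis imageI mem(1))
    next
      fix a b assume "a \<in> T ` V" "b \<in> T ` V"
      then show "a + b \<in> T ` V" by (auto simp flip: T_add)
    next
      fix r a assume "a \<in> T ` V"
      then show "r *\<^sub>R a \<in> T ` V" by (auto simp flip: T_scale)
    qed
  next
    fix a b assume "a \<in> H" "b \<in> H"
    then show "ip a b = ip b a" by (auto simp: H_def ip commute)
  next
    fix a b c assume "a \<in> H" "b \<in> H" "c \<in> H"
    then show "ip (a + b) c = ip a c + ip b c"
      by (auto simp: H_def ip add_left simp flip: T_add)
  next
    fix a b r assume "a \<in> H" "b \<in> H"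
    then show "ip (r *\<^sub>R a) b = r * ip a b"
      by (auto simp: H_def ip scale_left simp flip: T_scale)
  next
    fix a assume "a \<in> H"
    then show "0 \<le> ip a a" by (auto simp: H_def ip nonneg)
  next
    fix a assume "a \<in> H" "ip a a = 0"
    then obtain x where x: "x \<in> V" "a = T x" "B x x = 0"
      by (auto simp: H_def ip)
    have "B x y = 0" if "y \<in> V" for y
      using Cauchy_Schwarz[OF x(1) that] x(3) by (simp add: seminorm_def)
    then show "a = 0" using x by (auto simp: T_def)
  qed
  have dist_T: "ip_dist H ip (T x) (T y) = seminorm (x - y)" if "x \<in> V" "y \<in> V" for x y
    using that by (simp add: ip_dist_def ip seminorm_def flip: T_diff) (simp add: H_def)
  have "H.metric.mcomplete"
    unfolding H.metric.mcomplete_def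
  proof (intro allI impI)
    fix \<sigma> assume \<sigma>: "H.metric.MCauchy \<sigma>"
    then have "range \<sigma> \<subseteq> T ` V"
      unfolding H.metric.MCauchy_def by (simp add: H_def)
    then have "\<forall>n. \<exists>w. w \<in> V \<and> \<sigma> n = T w"
      by blast
    then obtain w where w: "\<And>n. w n \<in> V" "\<And>n. \<sigma> n = T (w n)"
      by metis
    have "w \<in> Cauchy_seqs"
      using \<sigma> w by (auto simp: H.metric.MCauchy_def Cauchy_seqs_def dist_T)
    then obtain l where l: "l \<in> V" and lim: "(\<lambda>n. seminorm (w n - l)) \<longlonglongrightarrow> 0"
      using complete by blast
    have "limitin H.metric.mtopology \<sigma> (T l) sequentially"
      unfolding H.metric.limit_metric_sequentially
    proof (intro conjI allI impI)
      show "T l \<in> H" using l by (simp add: H_def)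
      fix e :: real assume "e > 0"
      then show "\<exists>N. \<forall>n\<ge>N. \<sigma> n \<in> H \<and> ip_dist H ip (\<sigma> n) (T l) < e"
        using LIMSEQ_D[OF lim, of e] w l
        by (auto simp: dist_T seminorm_nonneg) (auto simp: H_def)
    qed
    then show "\<exists>x. limitin H.metric.mtopology \<sigma> x sequentially" by blast
  qed
  then have "hilbert_space H ip"
    by unfold_locales
  moreover have "T \<in> V \<rightarrow> H" by (auto simp: H_def)
  ultimately show thesis using that dist_T by blast
qed

lemma const_Cauchy_seqs: "v \<in> V \<Longrightarrow> (\<lambda>_. v) \<in> Cauchy_seqs"
  by (auto simp: Cauchy_seqs_def seminorm_def zero_left)

lemma Cauchy_seqs_mem: "c \<in> Cauchy_seqs \<Longrightarrow> c n \<in> V"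
  by (simp add: Cauchy_seqs_def)

lemma subspace_Cauchy_seqs: "subspace Cauchy_seqs"
  unfolding subspace_def
proof (intro conjI ballI allI)
  show "0 \<in> Cauchy_seqs"
    using const_Cauchy_seqs[of 0] by (simp add: zero_fun_def)
next
  fix c d assume c: "c \<in> Cauchy_seqs" and d: "d \<in> Cauchy_seqs"
  show "c + d \<in> Cauchy_seqs"
    unfolding Cauchy_seqs_def
  proof (intro CollectI conjI allI impI)
    show "(c + d) n \<in> V" for n
      using c d by (simp add: Cauchy_seqs_mem)
    fix e :: real assume "e > 0"
    then obtain M N where M: "\<forall>m\<ge>M. \<forall>n\<ge>M. seminorm (c m - c n) < e / 2"
      and N: "\<forall>m\<ge>N. \<forall>n\<ge>N. seminorm (d m - d n) < e / 2"
      using c d unfolding Cauchy_seqs_def mem_Collect_eq by (meson half_gt_zero)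
    have "seminorm ((c + d) m - (c + d) n) < e" if "m \<ge> max M N" "n \<ge> max M N" for m n
    proof -
      have "(c + d) m - (c + d) n = (c m - c n) + (d m - d n)" by simp
      then have "seminorm ((c + d) m - (c + d) n) \<le> seminorm (c m - c n) + seminorm (d m - d n)"
        using c d by (simp only: seminorm_triangle Cauchy_seqs_mem mem)
      moreover have "seminorm (c m - c n) < e / 2" "seminorm (d m - d n) < e / 2"
        using M N that by simp_all
      ultimately show ?thesis by linarith
    qed
    then show "\<exists>N. \<forall>m\<ge>N. \<forall>n\<ge>N. seminorm ((c + d) m - (c + d) n) < e" by blast
  qed
next
  fix r and c assume c: "c \<in> Cauchy_seqs"
  show "r *\<^sub>R c \<in> Cauchy_seqs"
    unfolding Cauchy_seqs_def
  proof (intro CollectI conjI allI impI)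
    show "(r *\<^sub>R c) n \<in> V" for n
      using c by (simp add: Cauchy_seqs_mem scaleR_fun_def)
    fix e :: real assume e: "e > 0"
    \<comment> \<open>The summand 1 keeps the divisor positive when \<open>r = 0\<close>.\<close>
    then obtain N where N: "\<forall>m\<ge>N. \<forall>n\<ge>N. seminorm (c m - c n) < e / (\<bar>r\<bar> + 1)"
      using c unfolding Cauchy_seqs_def mem_Collect_eq
      by (metis abs_ge_zero add_nonneg_pos divide_pos_pos zero_less_one)
    have "seminorm ((r *\<^sub>R c) m - (r *\<^sub>R c) n) < e" if "m \<ge> N" "n \<ge> N" for m n
    proof -
      have "(r *\<^sub>R c) m - (r *\<^sub>R c) n = r *\<^sub>R (c m - c n)"
        by (simp add: scaleR_fun_def scaleR_diff_right)
      then have "seminorm ((r *\<^sub>R c) m - (r *\<^sub>R c) n) = \<bar>r\<bar> * seminorm (c m - c n)"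
        using c by (simp only: seminorm_scale Cauchy_seqs_mem mem)
      also have "\<dots> \<le> (\<bar>r\<bar> + 1) * seminorm (c m - c n)"
        using c by (intro mult_right_mono) (simp_all add: seminorm_nonneg Cauchy_seqs_mem)
      also have "\<dots> < e"
        using N that by (simp add: field_simps)
      finally show ?thesis .
    qed
    then show "\<exists>N. \<forall>m\<ge>N. \<forall>n\<ge>N. seminorm ((r *\<^sub>R c) m - (r *\<^sub>R c) n) < e" by blast
  qed
qed

definition lim_form :: "(nat \<Rightarrow> 'v) \<Rightarrow> (nat \<Rightarrow> 'v) \<Rightarrow> real"
  where "lim_form c d = lim (\<lambda>n. B (c n) (d n))"

lemma convergent_seminorm:
  assumes c: "c \<in> Cauchy_seqs"
  shows "convergent (\<lambda>n. seminorm (c n))"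
  unfolding Cauchy_convergent_iff[symmetric] Cauchy_def
proof (intro allI impI)
  fix e :: real assume "e > 0"
  then obtain N where N: "\<forall>m\<ge>N. \<forall>n\<ge>N. seminorm (c m - c n) < e"
    using c unfolding Cauchy_seqs_def by blast
  have "dist (seminorm (c m)) (seminorm (c n)) < e" if "m \<ge> N" "n \<ge> N" for m n
  proof -
    have "seminorm (c m - c n) < e" using N that by blast
    then show ?thesis
      using seminorm_reverse_triangle[of "c m" "c n"] c by (simp add: dist_real_def Cauchy_seqs_mem)
  qed
  then show "\<exists>M. \<forall>m\<ge>M. \<forall>n\<ge>M. dist (seminorm (c m)) (seminorm (c n)) < e" by blast
qed

text \<open>By polarization, convergence of the form reduces to convergence of the seminorms.\<close>

lemma lim_form:
  assumes c: "c \<in> Cauchy_seqs" and d: "d \<in> Cauchy_seqs"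
  shows "(\<lambda>n. B (c n) (d n)) \<longlonglongrightarrow> lim_form c d"
proof -
  have polar: "B (c n) (d n) = ((seminorm ((c + d) n))\<^sup>2 - (seminorm ((c - d) n))\<^sup>2) / 4" for n
    using c d commute[of "d n" "c n"]
    by (simp add: seminorm_sq Cauchy_seqs_mem add_left add_right diff_left diff_right)
  have "convergent (\<lambda>n. seminorm ((c + d) n))" "convergent (\<lambda>n. seminorm ((c - d) n))"
    using subspace_Cauchy_seqs c d by (intro convergent_seminorm subspace_add subspace_diff; simp)+
  then have "convergent (\<lambda>n. ((seminorm ((c + d) n))\<^sup>2 - (seminorm ((c - d) n))\<^sup>2) / 4)"
    unfolding convergent_def by (elim exE) (rule exI, (rule tendsto_intros | assumption | simp)+)
  then have "convergent (\<lambda>n. B (c n) (d n))"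
    unfolding polar .
  then show ?thesis by (simp add: lim_form_def convergent_LIMSEQ_iff)
qed

text \<open>The Cauchy sequences carry the same structure as \<open>V\<close>, so the facts above
  hold for them too under the prefix \<open>seqs\<close>, including the quotient
  construction.\<close>

interpretation seqs: semi_inner_product_space Cauchy_seqs lim_form
proof
  show "subspace Cauchy_seqs" by (fact subspace_Cauchy_seqs)
next
  fix c d assume "c \<in> Cauchy_seqs" "d \<in> Cauchy_seqs"
  then show "lim_form c d = lim_form d c"
    by (simp add: lim_form_def commute Cauchy_seqs_mem)
next
  fix c d e assume cde: "c \<in> Cauchy_seqs" "d \<in> Cauchy_seqs" "e \<in> Cauchy_seqs"
  then have "(\<lambda>n. B ((c + d) n) (e n)) \<longlonglongrightarrow> lim_form c e + lim_form d e"
    using tendsto_add[OF lim_form[of c e] lim_form[of d e]] by (simp add: add_left Cauchy_seqs_mem)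
  then show "lim_form (c + d) e = lim_form c e + lim_form d e"
    unfolding lim_form_def[of "c + d"] by (rule limI)
next
  fix r c d assume cd: "c \<in> Cauchy_seqs" "d \<in> Cauchy_seqs"
  then have "(\<lambda>n. B ((r *\<^sub>R c) n) (d n)) \<longlonglongrightarrow> r * lim_form c d"
    using tendsto_mult_left[OF lim_form[of c d], of r]
    by (simp add: scale_left Cauchy_seqs_mem scaleR_fun_def)
  then show "lim_form (r *\<^sub>R c) d = r * lim_form c d"
    unfolding lim_form_def[of "r *\<^sub>R c"] by (rule limI)
next
  fix c assume c: "c \<in> Cauchy_seqs"
  then show "0 \<le> lim_form c c"
    by (intro LIMSEQ_le_const[OF lim_form[OF c c]]) (auto simp: nonneg Cauchy_seqs_mem)
qed

lemma seqs_seminorm: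
  assumes "c \<in> Cauchy_seqs"
  shows "(\<lambda>n. seminorm (c n)) \<longlonglongrightarrow> seqs.seminorm c"
  unfolding seminorm_def seqs.seminorm_def using assms by (intro tendsto_real_sqrt lim_form)

lemma seqs_seminorm_const: "v \<in> V \<Longrightarrow> seqs.seminorm (\<lambda>_. v) = seminorm v"
  using seqs_seminorm[OF const_Cauchy_seqs] by (simp add: LIMSEQ_const_iff)

text \<open>The distance from \<open>c\<close> to the constant sequence with value
  \<open>c n\<close> is the limit over \<open>m\<close> of \<open>seminorm (c m - c n)\<close>,
  which is small for large \<open>n\<close> by the Cauchy property.\<close>

lemma const_seqs_dense:
  assumes c: "c \<in> Cauchy_seqs" and "e > 0"
  obtains N where "\<forall>n\<ge>N. seqs.seminorm (c - (\<lambda>_. c n)) \<le> e"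
proof -
  obtain N where N: "\<forall>m\<ge>N. \<forall>n\<ge>N. seminorm (c m - c n) < e"
    using assms unfolding Cauchy_seqs_def by blast
  have "seqs.seminorm (c - (\<lambda>_. c n)) \<le> e" if "n \<ge> N" for n
  proof (rule LIMSEQ_le_const2)
    show "(\<lambda>m. seminorm ((c - (\<lambda>_. c n)) m)) \<longlonglongrightarrow> seqs.seminorm (c - (\<lambda>_. c n))"
      using c by (intro seqs_seminorm seqs.mem const_Cauchy_seqs Cauchy_seqs_mem)
    show "\<exists>N. \<forall>m\<ge>N. seminorm ((c - (\<lambda>_. c n)) m) \<le> e"
      using N that by (auto intro!: exI[of _ N] less_imp_le)
  qed
  then show thesis using that by blast
qed

text \<open>A diagonal argument: each \<open>C k\<close> is within \<open>1 / (k + 1)\<close> of the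
  constant sequence with some value \<open>v k\<close>. The sequence \<open>v\<close> is then
  Cauchy, and it is a limit of \<open>C\<close>.\<close>

lemma seqs_complete:
  assumes C: "C \<in> seqs.Cauchy_seqs"
  shows "\<exists>l\<in>Cauchy_seqs. (\<lambda>k. seqs.seminorm (C k - l)) \<longlonglongrightarrow> 0"
proof -
  have Ck: "C k \<in> Cauchy_seqs" for k
    using C by (rule seqs.Cauchy_seqs_mem)
  have "\<exists>v\<in>V. seqs.seminorm (C k - (\<lambda>_. v)) \<le> inverse (real (Suc k))" for k
    using const_seqs_dense[OF Ck[of k], of "inverse (real (Suc k))"] Cauchy_seqs_mem[OF Ck[of k]]
    by (metis inverse_positive_iff_positive of_nat_0_less_iff order_refl zero_less_Suc)
  then obtain v where v: "\<And>k. v k \<in> V"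
    and near: "\<And>k. seqs.seminorm (C k - (\<lambda>_. v k)) \<le> inverse (real (Suc k))"
    by metis
  have "v \<in> Cauchy_seqs"
    unfolding Cauchy_seqs_def
  proof (intro CollectI conjI allI impI v)
    fix e :: real assume "e > 0"
    then have e: "e / 3 > 0" by simp
    obtain M where M: "\<forall>m\<ge>M. \<forall>n\<ge>M. seqs.seminorm (C m - C n) < e / 3"
      using C e unfolding seqs.Cauchy_seqs_def by blast
    obtain N where N: "inverse (real (Suc N)) < e / 3"
      using reals_Archimedean[OF e] by blast
    have small: "seqs.seminorm (C k - (\<lambda>_. v k)) < e / 3" if "k \<ge> N" for k
    proof -
      have "inverse (real (Suc k)) \<le> inverse (real (Suc N))"
        using that by (intro le_imp_inverse_le) auto
      then show ?thesis using near[of k] N by linarith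
    qed
    have "seminorm (v m - v n) < e" if "m \<ge> max M N" "n \<ge> max M N" for m n
    proof -
      have in_C: "(\<lambda>_. v m) \<in> Cauchy_seqs" "(\<lambda>_. v n) \<in> Cauchy_seqs"
        using v by (auto intro: const_Cauchy_seqs)
      have "(\<lambda>_::nat. v m) - (\<lambda>_. v n) = (\<lambda>_. v m - v n)" by (simp add: fun_eq_iff)
      then have "seminorm (v m - v n) = seqs.seminorm ((\<lambda>_. v m) - (\<lambda>_. v n))"
        using v by (simp add: seqs_seminorm_const)
      also have "\<dots> \<le> seqs.seminorm ((\<lambda>_. v m) - C m) + seqs.seminorm (C m - (\<lambda>_. v n))"
        by (intro seqs.seminorm_triangle_diff in_C Ck)
      also have "\<dots> \<le> seqs.seminorm ((\<lambda>_. v m) - C m) +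
          (seqs.seminorm (C m - C n) + seqs.seminorm (C n - (\<lambda>_. v n)))"
        by (intro add_left_mono seqs.seminorm_triangle_diff in_C Ck)
      also have "\<dots> < e / 3 + (e / 3 + e / 3)"
        using small that M seqs.seminorm_minus_commute[OF in_C(1) Ck[of m]]
        by (intro add_strict_mono) auto
      finally show ?thesis by simp
    qed
    then show "\<exists>N. \<forall>m\<ge>N. \<forall>n\<ge>N. seminorm (v m - v n) < e" by blast
  qed
  moreover have "(\<lambda>k. seqs.seminorm (C k - v)) \<longlonglongrightarrow> 0"
  proof (rule LIMSEQ_I)
    fix e :: real assume "e > 0"
    then have e: "e / 3 > 0" by simp
    obtain M where M: "\<forall>n\<ge>M. seqs.seminorm (v - (\<lambda>_. v n)) \<le> e / 3"
      using const_seqs_dense[OF \<open>v \<in> Cauchy_seqs\<close> e] by blast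
    obtain N where N: "inverse (real (Suc N)) < e / 3"
      using reals_Archimedean[OF e] by blast
    have "norm (seqs.seminorm (C k - v) - 0) < e" if "k \<ge> max M N" for k
    proof -
      have in_C: "(\<lambda>_. v k) \<in> Cauchy_seqs" using v by (rule const_Cauchy_seqs)
      have "inverse (real (Suc k)) \<le> inverse (real (Suc N))"
        using that by (intro le_imp_inverse_le) auto
      then have "seqs.seminorm (C k - (\<lambda>_. v k)) < e / 3" using near[of k] N by linarith
      moreover have "seqs.seminorm ((\<lambda>_. v k) - v) \<le> e / 3"
        using M that seqs.seminorm_minus_commute[OF in_C \<open>v \<in> Cauchy_seqs\<close>] by simp
      moreover have "seqs.seminorm (C k - v) \<le> seqs.seminorm (C k - (\<lambda>_. v k)) + seqs.seminorm ((\<lambda>_. v k) - v)"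
        by (intro seqs.seminorm_triangle_diff in_C Ck \<open>v \<in> Cauchy_seqs\<close>)
      ultimately show ?thesis
        using \<open>e > 0\<close> seqs.seminorm_nonneg[OF seqs.mem(3)[OF Ck[of k] \<open>v \<in> Cauchy_seqs\<close>]] by simp
    qed
    then show "\<exists>N. \<forall>k\<ge>N. norm (seqs.seminorm (C k - v) - 0) < e" by blast
  qed
  ultimately show ?thesis by blast
qed

text \<open>Vectors of \<open>V\<close> are mapped to constant sequences, and these to the quotient
  of the complete space of Cauchy sequences. Only the preservation of distances is recorded, which
  is all that a coarse embedding sees.\<close>

lemma Hilbert_completion:
  obtains H :: "((nat \<Rightarrow> 'v) \<Rightarrow> real) set" and ip T where
    "hilbert_space H ip" "T \<in> V \<rightarrow> H"
    "\<And>x y. \<lbrakk>x \<in> V; y \<in> V\<rbrakk> \<Longrightarrow> ip_dist H ip (T x) (T y) = seminorm (x - y)"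
proof -
  obtain H :: "((nat \<Rightarrow> 'v) \<Rightarrow> real) set" and ip T where
    H: "hilbert_space H ip" "T \<in> Cauchy_seqs \<rightarrow> H"
      "\<And>c d. \<lbrakk>c \<in> Cauchy_seqs; d \<in> Cauchy_seqs\<rbrakk> \<Longrightarrow> ip_dist H ip (T c) (T d) = seqs.seminorm (c - d)"
    using seqs.quotient_Hilbert_space[OF seqs_complete] by metis
  have "ip_dist H ip (T (\<lambda>_. x)) (T (\<lambda>_. y)) = seminorm (x - y)" if "x \<in> V" "y \<in> V" for x y
    using that H(3)[OF const_Cauchy_seqs const_Cauchy_seqs]
      seqs_seminorm_const[of "x - y"] by (simp add: fun_diff_def)
  then show thesis
    using that[of H ip "\<lambda>x. T (\<lambda>_. x)"] H(1,2) const_Cauchy_seqs by blast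
qed

end


section \<open>Positive semidefinite kernels\<close>

text \<open>Meant for finite \<open>I\<close>: over an infinite set the sums are 0 and every kernel
  qualifies. Kernels on a whole space are treated through all finite subsets. The indices need not
  be points, so families with repetitions are covered.\<close>

definition positive_semidefinite :: "'i set \<Rightarrow> ('i \<Rightarrow> 'i \<Rightarrow> real) \<Rightarrow> bool"
  where "positive_semidefinite I k \<longleftrightarrow> (\<forall>c. 0 \<le> (\<Sum>i\<in>I. \<Sum>j\<in>I. c i * c j * k i j))"

lemma positive_semidefiniteD:
  "positive_semidefinite I k \<Longrightarrow> 0 \<le> (\<Sum>i\<in>I. \<Sum>j\<in>I. c i * c j * k i j)"
  by (simp add: positive_semidefinite_def)

lemma positive_semidefinite_cong:
  assumes "\<And>i j. \<lbrakk>i \<in> I; j \<in> I\<rbrakk> \<Longrightarrow> k i j = l i j"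
  shows "positive_semidefinite I k \<longleftrightarrow> positive_semidefinite I l"
  using assms by (simp add: positive_semidefinite_def cong: sum.cong)

lemma positive_semidefinite_subset:
  assumes k: "positive_semidefinite I k" and "finite I" "J \<subseteq> I"
  shows "positive_semidefinite J k"
  unfolding positive_semidefinite_def
proof
  fix c :: "'a \<Rightarrow> real"
  define c' where "c' i = (if i \<in> J then c i else 0)" for i
  have "(\<Sum>i\<in>J. \<Sum>j\<in>J. c i * c j * k i j) = (\<Sum>i\<in>J. \<Sum>j\<in>I. c' i * c' j * k i j)"
    using assms by (intro sum.cong refl sum.mono_neutral_cong_left) (auto simp: c'_def)
  also have "\<dots> = (\<Sum>i\<in>I. \<Sum>j\<in>I. c' i * c' j * k i j)"
    using assms by (intro sum.mono_neutral_left) (auto simp: c'_def)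
  finally show "0 \<le> (\<Sum>i\<in>J. \<Sum>j\<in>J. c i * c j * k i j)"
    using positive_semidefiniteD[OF k] by simp
qed

lemma positive_semidefinite_const: "0 \<le> r \<Longrightarrow> positive_semidefinite I (\<lambda>_ _. r)"
  by (simp add: positive_semidefinite_def flip: sum_distrib_right sum_product)

lemma positive_semidefinite_add:
  "\<lbrakk>positive_semidefinite I k; positive_semidefinite I l\<rbrakk>
    \<Longrightarrow> positive_semidefinite I (\<lambda>i j. k i j + l i j)"
  by (simp add: positive_semidefinite_def distrib_left sum.distrib)

lemma positive_semidefinite_sum:
  "(\<And>n. n \<in> A \<Longrightarrow> positive_semidefinite I (k n)) \<Longrightarrow> positive_semidefinite I (\<lambda>i j. \<Sum>n\<in>A. k n i j)"
  by (induction A rule: infinite_finite_induct)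
    (simp_all add: positive_semidefinite_const positive_semidefinite_add)

lemma positive_semidefinite_rescale:
  assumes "positive_semidefinite I k"
  shows "positive_semidefinite I (\<lambda>i j. a i * a j * k i j)"
  unfolding positive_semidefinite_def
proof
  fix c
  show "0 \<le> (\<Sum>i\<in>I. \<Sum>j\<in>I. c i * c j * (a i * a j * k i j))"
    using positive_semidefiniteD[OF assms, of "\<lambda>i. c i * a i"] by (simp add: mult_ac)
qed

lemma positive_semidefinite_scale:
  assumes "positive_semidefinite I k" "0 \<le> r"
  shows "positive_semidefinite I (\<lambda>i j. r * k i j)"
  using positive_semidefinite_rescale[OF assms(1), of "\<lambda>_. sqrt r"] assms(2) by simp

lemma positive_semidefinite_limit:
  assumes "\<And>n. positive_semidefinite I (k n)"
    and "\<And>i j. \<lbrakk>i \<in> I; j \<in> I\<rbrakk> \<Longrightarrow> (\<lambda>n. k n i j) \<longlonglongrightarrow> l i j"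
  shows "positive_semidefinite I l"
  unfolding positive_semidefinite_def
proof
  fix c
  have "(\<lambda>n. \<Sum>i\<in>I. \<Sum>j\<in>I. c i * c j * k n i j) \<longlonglongrightarrow> (\<Sum>i\<in>I. \<Sum>j\<in>I. c i * c j * l i j)"
    by (intro tendsto_sum tendsto_mult_left assms(2))
  then show "0 \<le> (\<Sum>i\<in>I. \<Sum>j\<in>I. c i * c j * l i j)"
    by (rule LIMSEQ_le_const) (use positive_semidefiniteD[OF assms(1)] in blast)
qed

text \<open>If \<open>k\<close> is the Gram kernel of vectors \<open>v (i, a)\<close>, the result is
  the Gram kernel of their sums over \<open>a\<close>. In general it comes from testing
  \<open>k\<close> with coefficients that depend on \<open>i\<close> only.\<close>

lemma positive_semidefinite_marginal:
  assumes "positive_semidefinite (I \<times> A) k"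
  shows "positive_semidefinite I (\<lambda>i j. \<Sum>a\<in>A. \<Sum>b\<in>A. k (i, a) (j, b))"
  unfolding positive_semidefinite_def
proof
  fix c
  have "(\<Sum>i\<in>I. \<Sum>j\<in>I. c i * c j * (\<Sum>a\<in>A. \<Sum>b\<in>A. k (i, a) (j, b)))
      = (\<Sum>i\<in>I. \<Sum>j\<in>I. \<Sum>a\<in>A. \<Sum>b\<in>A. c i * c j * k (i, a) (j, b))"
    by (simp add: sum_distrib_left)
  also have "\<dots> = (\<Sum>i\<in>I. \<Sum>a\<in>A. \<Sum>j\<in>I. \<Sum>b\<in>A. c i * c j * k (i, a) (j, b))"
    by (intro sum.cong refl sum.swap)
  also have "\<dots> = (\<Sum>p\<in>I \<times> A. \<Sum>q\<in>I \<times> A. c (fst p) * c (fst q) * k p q)"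
    by (simp add: sum.cartesian_product')
  finally show "0 \<le> (\<Sum>i\<in>I. \<Sum>j\<in>I. c i * c j * (\<Sum>a\<in>A. \<Sum>b\<in>A. k (i, a) (j, b)))"
    using positive_semidefiniteD[OF assms, of "\<lambda>p. c (fst p)"] by simp
qed

context inner_product_space
begin

text \<open>
  A case of the Schur product theorem. In the induction step one splits off the component of all
  vectors in the direction of \<open>x s\<close>, which leaves a Gram matrix whose \<open>s\<close>-th row vanishes.
  If \<open>x s = 0\<close>, the division by zero makes the split trivial.
\<close>

lemma positive_semidefinite_mult_Gram:
  assumes "finite I" "positive_semidefinite I k" "x \<in> I \<rightarrow> H"
  shows "positive_semidefinite I (\<lambda>i j. k i j * ip (x i) (x j))"
  using assms
proof (induction I arbitrary: x rule: finite_induct)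
  case empty
  then show ?case by (simp add: positive_semidefinite_def)
next
  case (insert s F)
  have xH: "x i \<in> H" if "i \<in> insert s F" for i
    using insert.prems(2) that by blast
  define a where "a i = ip (x s) (x i) / sqrt (ip (x s) (x s))" for i
  define y where "y i = x i - (ip (x s) (x i) / ip (x s) (x s)) *\<^sub>R x s" for i
  have yH: "y i \<in> H" if "i \<in> insert s F" for i
    using xH that by (simp add: y_def)
  have ys: "y s = 0"
    using ip_definite[of "x s"] xH by (cases "ip (x s) (x s) = 0") (auto simp: y_def)
  have split: "ip (x i) (x j) = ip (y i) (y j) + a i * a j"
    if ij: "i \<in> insert s F" "j \<in> insert s F" for i j
  proof (cases "ip (x s) (x s) = 0")
    case False
    then have "0 < ip (x s) (x s)" using ip_nonneg[of "x s"] xH by fastforce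
    then show ?thesis
      using xH[OF ij(1)] xH[OF ij(2)] xH[of s] ip_commute[of "x i" "x s"]
      by (simp add: y_def a_def ip_diff_left ip_diff_right ip_scale_left ip_scale_right)
  qed (simp add: a_def y_def)
  have "positive_semidefinite F k"
    using insert.prems(1) insert.hyps(1) positive_semidefinite_subset[of "insert s F" k F] by blast
  then have IH: "positive_semidefinite F (\<lambda>i j. k i j * ip (y i) (y j))"
    using yH by (intro insert.IH) auto
  have zero: "ip 0 (y j) = 0" "ip (y j) 0 = 0" if "j \<in> insert s F" for j
    using yH[OF that] ip_commute[of 0 "y j"] by (simp_all add: ip_zero_left)
  have "positive_semidefinite (insert s F) (\<lambda>i j. k i j * ip (y i) (y j))"
    unfolding positive_semidefinite_def
  proof
    fix c
    show "0 \<le> (\<Sum>i\<in>insert s F. \<Sum>j\<in>insert s F. c i * c j * (k i j * ip (y i) (y j)))"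
      using positive_semidefiniteD[OF IH, of c] insert.hyps ys zero by simp
  qed
  then have "positive_semidefinite (insert s F) (\<lambda>i j. k i j * ip (y i) (y j) + a i * a j * k i j)"
    by (intro positive_semidefinite_add positive_semidefinite_rescale insert.prems(1))
  then show ?case
    by (subst positive_semidefinite_cong[where l = "\<lambda>i j. k i j * ip (y i) (y j) + a i * a j * k i j"])
      (simp_all add: split algebra_simps)
qed

text \<open>The exponential series is a limit of combinations of powers of the Gram kernel with
  nonnegative coefficients. The powers are positive semidefinite by induction, multiplying by one
  Gram factor at a time.\<close>

lemma positive_semidefinite_exp_Gram:
  assumes "finite I" "x \<in> I \<rightarrow> H" "0 \<le> r"
  shows "positive_semidefinite I (\<lambda>i j. exp (r * ip (x i) (x j)))"
proof (rule positive_semidefinite_limit)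
  have pow: "positive_semidefinite I (\<lambda>i j. ip (x i) (x j) ^ n)" for n
  proof (induction n)
    case 0
    then show ?case by (simp add: positive_semidefinite_const)
  next
    case (Suc n)
    then show ?case
      using positive_semidefinite_mult_Gram[OF assms(1) Suc assms(2)] by (simp add: mult.commute)
  qed
  show "positive_semidefinite I (\<lambda>i j. \<Sum>n<N. (r ^ n / fact n) * ip (x i) (x j) ^ n)" for N
    using assms(3) by (intro positive_semidefinite_sum positive_semidefinite_scale pow) simp
  show "(\<lambda>N. \<Sum>n<N. (r ^ n / fact n) * ip (x i) (x j) ^ n) \<longlonglongrightarrow> exp (r * ip (x i) (x j))" for i j
    using exp_converges[of "r * ip (x i) (x j)"]
    by (simp add: sums_def power_mult_distrib divide_inverse mult_ac)
qed

text \<open>Expanding the squared distance turns the Gaussian into the exponential of a Gram kernel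
  times one factor for each of \<open>i\<close> and \<open>j\<close>, that is, a rescaling.\<close>

lemma positive_semidefinite_Gaussian:
  assumes "finite I" "x \<in> I \<rightarrow> H"
  shows "positive_semidefinite I (\<lambda>i j. exp (- (t * ip_dist H ip (x i) (x j))\<^sup>2))"
proof -
  define a where "a i = exp (- (t\<^sup>2 * ip (x i) (x i)))" for i
  have "exp (- (t * ip_dist H ip (x i) (x j))\<^sup>2) = a i * a j * exp (2 * t\<^sup>2 * ip (x i) (x j))"
    if "i \<in> I" "j \<in> I" for i j
  proof -
    have H: "x i \<in> H" "x j \<in> H" using assms(2) that by auto
    then have "(t * ip_dist H ip (x i) (x j))\<^sup>2 = t\<^sup>2 * ip (x i - x j) (x i - x j)"
      by (simp add: ip_dist_def power_mult_distrib ip_nonneg)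
    also have "\<dots> = t\<^sup>2 * ip (x i) (x i) + t\<^sup>2 * ip (x j) (x j) - 2 * t\<^sup>2 * ip (x i) (x j)"
      using H ip_commute[of "x j" "x i"] by (simp add: ip_diff_left ip_diff_right algebra_simps)
    finally show ?thesis
      by (simp add: a_def flip: exp_add)
  qed
  then show ?thesis
    by (subst positive_semidefinite_cong)
      (assumption, intro positive_semidefinite_rescale positive_semidefinite_exp_Gram assms, simp)
qed

end

section \<open>Kernels of negative type and Schoenberg's theorem\<close>

text \<open>The squared distance of two vectors whose Gram kernel is \<open>k\<close>.\<close>

definition kernel_dist :: "('a \<Rightarrow> 'a \<Rightarrow> real) \<Rightarrow> 'a \<Rightarrow> 'a \<Rightarrow> real"
  where "kernel_dist k x y = k x x + k y y - 2 * k x y"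

definition conditionally_negative :: "'a set \<Rightarrow> ('a \<Rightarrow> 'a \<Rightarrow> real) \<Rightarrow> bool"
  where "conditionally_negative S N \<longleftrightarrow>
    (\<forall>F c. finite F \<longrightarrow> F \<subseteq> S \<longrightarrow> (\<Sum>x\<in>F. c x) = 0 \<longrightarrow> (\<Sum>x\<in>F. \<Sum>y\<in>F. c x * c y * N x y) \<le> 0)"

text \<open>As the coefficients sum to zero, the terms with \<open>k x x\<close> and
  \<open>k y y\<close> drop out, and -2 times a nonnegative quantity remains.\<close>

lemma conditionally_negative_kernel_dist:
  assumes "\<And>F. \<lbrakk>finite F; F \<subseteq> S\<rbrakk> \<Longrightarrow> positive_semidefinite F k"
  shows "conditionally_negative S (kernel_dist k)"
  unfolding conditionally_negative_def
proof (intro allI impI)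
  fix F and c :: "'a \<Rightarrow> real"
  assume F: "finite F" "F \<subseteq> S" and c: "(\<Sum>x\<in>F. c x) = 0"
  have "(\<Sum>x\<in>F. \<Sum>y\<in>F. c x * c y * k x x) = (\<Sum>x\<in>F. c x * k x x) * (\<Sum>y\<in>F. c y)"
    "(\<Sum>x\<in>F. \<Sum>y\<in>F. c x * c y * k y y) = (\<Sum>x\<in>F. c x) * (\<Sum>y\<in>F. c y * k y y)"
    by (simp_all only: sum_product) (simp_all add: mult_ac)
  moreover have "(\<Sum>x\<in>F. \<Sum>y\<in>F. c x * c y * kernel_dist k x y)
      = (\<Sum>x\<in>F. \<Sum>y\<in>F. c x * c y * k x x) + (\<Sum>x\<in>F. \<Sum>y\<in>F. c x * c y * k y y)
        - 2 * (\<Sum>x\<in>F. \<Sum>y\<in>F. c x * c y * k x y)"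
    by (simp add: kernel_dist_def distrib_left right_diff_distrib sum.distrib sum_subtractf
        sum_distrib_left mult_ac)
  ultimately have "(\<Sum>x\<in>F. \<Sum>y\<in>F. c x * c y * kernel_dist k x y)
      = - 2 * (\<Sum>x\<in>F. \<Sum>y\<in>F. c x * c y * k x y)"
    using c by simp
  then show "(\<Sum>x\<in>F. \<Sum>y\<in>F. c x * c y * kernel_dist k x y) \<le> 0"
    using positive_semidefiniteD[OF assms[OF F], of c] by simp
qed

lemma conditionally_negative_suminf:
  assumes neg: "\<And>n. conditionally_negative S (N n)"
    and sum: "\<And>x y. \<lbrakk>x \<in> S; y \<in> S\<rbrakk> \<Longrightarrow> summable (\<lambda>n. N n x y)"
  shows "conditionally_negative S (\<lambda>x y. \<Sum>n. N n x y)"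
  unfolding conditionally_negative_def
proof (intro allI impI)
  fix F and c :: "'a \<Rightarrow> real"
  assume F: "finite F" "F \<subseteq> S" and c: "(\<Sum>x\<in>F. c x) = 0"
  have sums: "(\<lambda>n. \<Sum>x\<in>F. \<Sum>y\<in>F. c x * c y * N n x y) sums (\<Sum>x\<in>F. \<Sum>y\<in>F. c x * c y * (\<Sum>n. N n x y))"
    using F by (intro sums_sum sums_mult summable_sums sum) auto
  show "(\<Sum>x\<in>F. \<Sum>y\<in>F. c x * c y * (\<Sum>n. N n x y)) \<le> 0"
  proof (rule sums_le[OF _ sums sums_zero])
    show "(\<Sum>x\<in>F. \<Sum>y\<in>F. c x * c y * N n x y) \<le> 0" for n
      using neg F c by (simp add: conditionally_negative_def)
  qed
qed

text \<open>Testing with the coefficients 1 at \<open>x\<close> and -1 at \<open>y\<close> gives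
  \<open>- 2 * N x y \<le> 0\<close>.\<close>

lemma conditionally_negative_nonneg:
  assumes "conditionally_negative S N" "x \<in> S" "y \<in> S" "N x x = 0" "N y y = 0" "N x y = N y x"
  shows "0 \<le> N x y"
proof (cases "x = y")
  case False
  define c where "c z = (if z = x then 1 else -1 :: real)" for z
  have "(\<Sum>u\<in>{x, y}. \<Sum>v\<in>{x, y}. c u * c v * N u v) \<le> 0"
    by (rule assms(1)[unfolded conditionally_negative_def, rule_format])
      (use assms(2,3) False in \<open>simp_all add: c_def\<close>)
  then show ?thesis using assms(4-6) False by (simp add: c_def)
qed (use assms in simp)

text \<open>Finitely supported functions on \<open>S\<close> with total mass zero carry a semi-inner
  product with kernel \<open>- N / 2\<close>. Differences of point masses have squared length
  \<open>N x y\<close> for it, so completing this space gives the embedding.\<close>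

lemma Schoenberg:
  fixes N :: "'a \<Rightarrow> 'a \<Rightarrow> real"
  assumes neg: "conditionally_negative S N"
    and diag: "\<And>x. x \<in> S \<Longrightarrow> N x x = 0"
    and sym: "\<And>x y. \<lbrakk>x \<in> S; y \<in> S\<rbrakk> \<Longrightarrow> N x y = N y x"
  obtains H :: "((nat \<Rightarrow> 'a \<Rightarrow> real) \<Rightarrow> real) set" and ip e where
    "hilbert_space H ip" "e \<in> S \<rightarrow> H"
    "\<And>x y. \<lbrakk>x \<in> S; y \<in> S\<rbrakk> \<Longrightarrow> ip_dist H ip (e x) (e y) = sqrt (N x y)"
proof -
  define supp where "supp u = {x. u x \<noteq> 0}" for u :: "'a \<Rightarrow> real"
  define V where "V = {u. finite (supp u) \<and> supp u \<subseteq> S \<and> (\<Sum>x\<in>supp u. u x) = 0}"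
  \<comment> \<open>The factor 1/2 compensates for the double sum at a difference of point masses,
    which contains both \<open>N x y\<close> and \<open>N y x\<close>.\<close>
  define B where "B u v = - (\<Sum>x\<in>supp u. \<Sum>y\<in>supp v. u x * v y * N x y) / 2" for u v
  have sum_eq: "(\<Sum>x\<in>supp u. u x) = (\<Sum>x\<in>F. u x)" if "finite F" "supp u \<subseteq> F" for u F
    using that by (intro sum.mono_neutral_left) (auto simp: supp_def)
  have VI: "u \<in> V" if "finite F" "F \<subseteq> S" "supp u \<subseteq> F" "(\<Sum>x\<in>F. u x) = 0" for u F
    using that sum_eq[of F u] by (auto simp: V_def intro: finite_subset)
  have B_eq: "B u v = - (\<Sum>x\<in>F. \<Sum>y\<in>F. u x * v y * N x y) / 2"
    if F: "finite F" "supp u \<subseteq> F" "supp v \<subseteq> F" for u v F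
  proof -
    have "(\<Sum>x\<in>supp u. \<Sum>y\<in>supp v. u x * v y * N x y) = (\<Sum>x\<in>supp u. \<Sum>y\<in>F. u x * v y * N x y)"
      using F by (intro sum.cong refl sum.mono_neutral_left) (auto simp: supp_def)
    also have "\<dots> = (\<Sum>x\<in>F. \<Sum>y\<in>F. u x * v y * N x y)"
      using F by (intro sum.mono_neutral_left) (auto simp: supp_def)
    finally show ?thesis by (simp add: B_def)
  qed
  have supp_add: "supp (u + v) \<subseteq> supp u \<union> supp v" for u v
    by (auto simp: supp_def)
  have supp_scale: "supp (r *\<^sub>R u) \<subseteq> supp u" for r u
    by (auto simp: supp_def scaleR_fun_def)
  interpret semi_inner_product_space V B
  proof
    show "subspace V"
      unfolding subspace_def
    proof (intro conjI ballI allI)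
      show "0 \<in> V" by (simp add: V_def supp_def)
    next
      fix u v assume uv: "u \<in> V" "v \<in> V"
      have fin: "finite (supp u \<union> supp v)" using uv by (simp add: V_def)
      show "u + v \<in> V"
      proof (rule VI[OF fin])
        show "(\<Sum>x\<in>supp u \<union> supp v. (u + v) x) = 0"
          using sum_eq[OF fin, of u] sum_eq[OF fin, of v] uv by (simp add: V_def sum.distrib)
      qed (use uv supp_add in \<open>auto simp: V_def\<close>)
    next
      fix r u assume u: "u \<in> V"
      then show "r *\<^sub>R u \<in> V"
        using supp_scale by (intro VI[of "supp u"]) (auto simp: V_def scaleR_fun_def simp flip: sum_distrib_left)
    qed
  next
    fix u v assume uv: "u \<in> V" "v \<in> V"
    have "B u v = - (\<Sum>y\<in>supp v. \<Sum>x\<in>supp u. u x * v y * N x y) / 2"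
      unfolding B_def by (subst sum.swap) simp
    also have "\<dots> = B v u"
      unfolding B_def using uv
      by (intro arg_cong[where f = "\<lambda>r. - r / 2"] sum.cong refl) (auto simp: V_def intro: sym)
    finally show "B u v = B v u" .
  next
    fix u v w assume "u \<in> V" "v \<in> V" "w \<in> V"
    then have fin: "finite (supp u \<union> supp v \<union> supp w)" by (simp add: V_def)
    show "B (u + v) w = B u w + B v w"
      using supp_add by (subst (1 2 3) B_eq[OF fin]) (auto simp: sum.distrib distrib_right add_divide_distrib)
  next
    fix r u v assume "u \<in> V" "v \<in> V"
    then have fin: "finite (supp u \<union> supp v)" by (simp add: V_def)
    show "B (r *\<^sub>R u) v = r * B u v"
      using supp_scale by (subst (1 2) B_eq[OF fin]) (auto simp: scaleR_fun_def sum_distrib_left mult_ac)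
  next
    fix u assume "u \<in> V"
    then show "0 \<le> B u u"
      using neg by (auto simp: B_def V_def conditionally_negative_def)
  qed
  obtain H :: "((nat \<Rightarrow> 'a \<Rightarrow> real) \<Rightarrow> real) set" and ip T where H: "hilbert_space H ip" "T \<in> V \<rightarrow> H"
    "\<And>x y. \<lbrakk>x \<in> V; y \<in> V\<rbrakk> \<Longrightarrow> ip_dist H ip (T x) (T y) = seminorm (x - y)"
    using Hilbert_completion by metis
  define \<delta> where "\<delta> x = (\<lambda>s. if s = x then 1 else 0 :: real)" for x :: 'a
  have dV: "\<delta> x - \<delta> y \<in> V" if "x \<in> S" "y \<in> S" for x y
    using that by (cases "x = y"; intro VI[of "{x, y}"]) (auto simp: supp_def \<delta>_def)
  have dN: "B (\<delta> x - \<delta> y) (\<delta> x - \<delta> y) = N x y" if xy: "x \<in> S" "y \<in> S" for x y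
  proof (cases "x = y")
    case False
    have "supp (\<delta> x - \<delta> y) \<subseteq> {x, y}" by (auto simp: supp_def \<delta>_def)
    then show ?thesis
      using False xy diag sym[of y x] by (subst B_eq[of "{x, y}"]) (auto simp: \<delta>_def)
  qed (simp add: B_def supp_def diag xy)
  \<comment> \<open>A point mass has total mass 1 and lies outside \<open>V\<close>. So the mass at
    a base point is subtracted, which cancels in differences.\<close>
  define x0 where "x0 = (SOME x. x \<in> S)"
  have x0: "x0 \<in> S" if "x \<in> S" for x
    unfolding x0_def using that by (rule someI)
  show thesis
  proof (rule that[OF H(1)])
    show "(\<lambda>x. T (\<delta> x - \<delta> x0)) \<in> S \<rightarrow> H"
      using H(2) dV x0 by blast
    show "ip_dist H ip (T (\<delta> x - \<delta> x0)) (T (\<delta> y - \<delta> x0)) = sqrt (N x y)" if "x \<in> S" "y \<in> S" for x y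
      using that x0 dV H(3) dN by (simp add: seminorm_def)
  qed
qed

section \<open>Elementary estimates for the Gaussian\<close>

text \<open>Since \<open>2 * x \<le> 1 + x^2 \<le> exp (x^2)\<close>, the slope of the Gaussian is
  at least -1, and adding the identity makes it nondecreasing. The other direction is its
  monotonicity on nonnegative arguments.\<close>

lemma exp_minus_square_Lipschitz:
  fixes s r :: real
  assumes "0 \<le> s" "0 \<le> r"
  shows "\<bar>exp (- s\<^sup>2) - exp (- r\<^sup>2)\<bar> \<le> \<bar>s - r\<bar>"
proof -
  have *: "exp (- s\<^sup>2) - exp (- r\<^sup>2) \<in> {0..r - s}" if "0 \<le> s" "s \<le> r" for s r :: real
  proof -
    have "exp (- s\<^sup>2) + s \<le> exp (- r\<^sup>2) + r"
    proof (rule DERIV_nonneg_imp_nondecreasing[OF that(2)])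
      fix x :: real
      have "((\<lambda>x. exp (- x\<^sup>2) + x) has_real_derivative exp (- x\<^sup>2) * (- (2 * x)) + 1) (at x)"
        by (auto intro!: derivative_eq_intros)
      moreover have "2 * x \<le> exp (x\<^sup>2)"
        using sum_squares_bound[of x 1] by (intro order_trans[OF _ exp_ge_add_one_self]) simp
      then have "0 \<le> exp (- x\<^sup>2) * (- (2 * x)) + 1"
        by (simp add: exp_minus field_simps)
      ultimately show "\<exists>y. ((\<lambda>x. exp (- x\<^sup>2) + x) has_real_derivative y) (at x) \<and> 0 \<le> y"
        by blast
    qed
    moreover have "exp (- r\<^sup>2) \<le> exp (- s\<^sup>2)"
      using that by (simp add: power_mono)
    ultimately show ?thesis by simp
  qed
  show ?thesis
    using *[of s r] *[of r s] assms by (cases "s \<le> r") auto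
qed

text \<open>With \<open>m\<close> the order of the group, this bounds
  \<open>m^2 * exp (- s^2)\<close>, the mixed term of two far orbits, by \<open>m / 2\<close>, which
  is half the lower bound for the diagonal terms.\<close>

lemma exp_minus_square_le:
  fixes s m :: real
  assumes "1 \<le> m" "2 * m \<le> s"
  shows "2 * m * exp (- s\<^sup>2) \<le> 1"
proof -
  have "2 * m \<le> (2 * m)\<^sup>2"
    using assms(1) by (simp add: power2_eq_square)
  also have "\<dots> \<le> s\<^sup>2"
    using assms by (intro power_mono) auto
  also have "\<dots> \<le> exp (s\<^sup>2)"
    using exp_ge_add_one_self[of "s\<^sup>2"] by linarith
  finally show ?thesis by (simp add: exp_minus field_simps)
qed


section \<open>Summing kernels over orbits\<close>

context isometric_group_action
begin

text \<open>If \<open>k\<close> is the Gram kernel of a feature map, this is the Gram kernel of the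
  sum of that map over the translates of a point. It is stated for points; invariance under
  translation in each argument lets it descend to orbits.\<close>

definition orbit_kernel :: "('c \<Rightarrow> 'c \<Rightarrow> real) \<Rightarrow> 'c \<Rightarrow> 'c \<Rightarrow> real"
  where "orbit_kernel k x y = (\<Sum>g\<in>carrier G. \<Sum>h\<in>carrier G. k (\<phi> g x) (\<phi> h y))"

text \<open>Right multiplication by \<open>g\<close> permutes the group.\<close>

lemma sum_translate:
  fixes u :: "'c \<Rightarrow> real"
  assumes "g \<in> carrier G" "x \<in> M"
  shows "(\<Sum>h\<in>carrier G. u (\<phi> h (\<phi> g x))) = (\<Sum>h\<in>carrier G. u (\<phi> h x))"
proof -
  interpret grp: group G using group_hom group_hom.axioms(1) by auto
  have "(\<Sum>h\<in>carrier G. u (\<phi> h (\<phi> g x))) = (\<Sum>h\<in>carrier G. u (\<phi> (h \<otimes> g) x))"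
    using assms by (simp add: composition_rule)
  also have "\<dots> = (\<Sum>h\<in>carrier G. u (\<phi> h x))"
  proof (rule sum.reindex_bij_witness[where i = "\<lambda>h. h \<otimes> inv g" and j = "\<lambda>h. h \<otimes> g"])
    fix h assume "h \<in> carrier G"
    then show "h \<otimes> g \<otimes> inv g = h" "h \<otimes> inv g \<otimes> g = h"
      using assms by (simp_all add: grp.m_assoc)
  qed (use assms in simp_all)
  finally show ?thesis .
qed

lemma orbit_kernel_translate_left:
  "\<lbrakk>g \<in> carrier G; x \<in> M\<rbrakk> \<Longrightarrow> orbit_kernel k (\<phi> g x) y = orbit_kernel k x y"
  unfolding orbit_kernel_def by (rule sum_translate)

lemma orbit_kernel_translate_right:
  "\<lbrakk>g \<in> carrier G; y \<in> M\<rbrakk> \<Longrightarrow> orbit_kernel k x (\<phi> g y) = orbit_kernel k x y"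
  unfolding orbit_kernel_def by (simp add: sum_translate)

lemma orbit_kernel_commute:
  assumes "\<And>a b. \<lbrakk>a \<in> M; b \<in> M\<rbrakk> \<Longrightarrow> k a b = k b a" "x \<in> M" "y \<in> M"
  shows "orbit_kernel k x y = orbit_kernel k y x"
proof -
  have "orbit_kernel k x y = (\<Sum>h\<in>carrier G. \<Sum>g\<in>carrier G. k (\<phi> g x) (\<phi> h y))"
    unfolding orbit_kernel_def by (rule sum.swap)
  also have "\<dots> = orbit_kernel k y x"
    unfolding orbit_kernel_def using assms by (intro sum.cong refl) (simp add: action_mem)
  finally show ?thesis .
qed

text \<open>The pair \<open>(x, g)\<close> stands for the translate \<open>\<phi> g x\<close>.
  Indexing by pairs counts a translate as often as the group produces it, just as the double sum
  does.\<close>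

lemma positive_semidefinite_orbit_kernel:
  assumes "positive_semidefinite (F \<times> carrier G) (\<lambda>(x, g) (y, h). k (\<phi> g x) (\<phi> h y))"
  shows "positive_semidefinite F (orbit_kernel k)"
  using positive_semidefinite_marginal[OF assms] by (simp add: orbit_kernel_def [abs_def])

lemma orbit_kernel_diag_ge:
  assumes "finite (carrier G)" "\<And>a b. \<lbrakk>a \<in> M; b \<in> M\<rbrakk> \<Longrightarrow> 0 \<le> k a b" "\<And>a. a \<in> M \<Longrightarrow> k a a = 1" "x \<in> M"
  shows "real (card (carrier G)) \<le> orbit_kernel k x x"
proof -
  have "k (\<phi> g x) (\<phi> g x) \<le> (\<Sum>h\<in>carrier G. k (\<phi> g x) (\<phi> h x))" if "g \<in> carrier G" for g
    using that assms by (intro member_le_sum) (auto simp: action_mem)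
  then have "(\<Sum>g\<in>carrier G. 1) \<le> orbit_kernel k x x"
    unfolding orbit_kernel_def using assms by (intro sum_mono) (metis action_mem)
  then show ?thesis by simp
qed

lemma orbit_kernel_le:
  assumes "\<And>g h. \<lbrakk>g \<in> carrier G; h \<in> carrier G\<rbrakk> \<Longrightarrow> k (\<phi> g x) (\<phi> h y) \<le> r"
  shows "orbit_kernel k x y \<le> (real (card (carrier G)))\<^sup>2 * r"
proof -
  have "orbit_kernel k x y \<le> (\<Sum>g\<in>carrier G. \<Sum>h\<in>carrier G. r)"
    unfolding orbit_kernel_def by (intro sum_mono assms)
  then show ?thesis by (simp add: power2_eq_square mult.assoc)
qed

text \<open>By invariance \<open>y\<close> may be replaced by its translate \<open>z\<close>. The
  squared distance is then a difference of two terms, each of which only moves the second argument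
  between \<open>x\<close> and \<open>z\<close>, and the bound \<open>r\<close> is summed over all
  pairs of group elements.\<close>

lemma kernel_dist_orbit_kernel_le:
  assumes sym: "\<And>a b. \<lbrakk>a \<in> M; b \<in> M\<rbrakk> \<Longrightarrow> k a b = k b a"
    and x: "x \<in> M" and y: "y \<in> M" and g0: "g0 \<in> carrier G"
    and Lip: "\<And>a g. \<lbrakk>a \<in> M; g \<in> carrier G\<rbrakk> \<Longrightarrow> \<bar>k a (\<phi> g x) - k a (\<phi> g (\<phi> g0 y))\<bar> \<le> r"
  shows "kernel_dist (orbit_kernel k) x y \<le> 2 * (real (card (carrier G)))\<^sup>2 * r"
proof -
  define z where "z = \<phi> g0 y"
  have z: "z \<in> M" using g0 y by (simp add: z_def action_mem)
  have diff: "\<bar>orbit_kernel k w x - orbit_kernel k w z\<bar> \<le> (real (card (carrier G)))\<^sup>2 * r" if "w \<in> M" for w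
  proof -
    have "\<bar>orbit_kernel k w x - orbit_kernel k w z\<bar>
        \<le> (\<Sum>g\<in>carrier G. \<Sum>h\<in>carrier G. \<bar>k (\<phi> g w) (\<phi> h x) - k (\<phi> g w) (\<phi> h z)\<bar>)"
      unfolding orbit_kernel_def sum_subtractf[symmetric]
      by (intro order_trans[OF sum_abs] sum_mono order_refl)
    also have "\<dots> \<le> (\<Sum>g\<in>carrier G. \<Sum>h\<in>carrier G. r)"
      using that by (intro sum_mono) (simp add: z_def Lip action_mem)
    finally show ?thesis by (simp add: power2_eq_square mult.assoc)
  qed
  have "kernel_dist (orbit_kernel k) x y = kernel_dist (orbit_kernel k) x z"
    using g0 y by (simp add: kernel_dist_def z_def orbit_kernel_translate_left orbit_kernel_translate_right)
  also have "\<dots> = (orbit_kernel k x x - orbit_kernel k x z) - (orbit_kernel k z x - orbit_kernel k z z)"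
    using orbit_kernel_commute[OF sym x z] by (simp add: kernel_dist_def)
  also have "\<dots> \<le> 2 * (real (card (carrier G)))\<^sup>2 * r"
    using diff[OF x] diff[OF z] by linarith
  finally show ?thesis .
qed

lemma orbit_dist_le:
  assumes "x \<in> M" "y \<in> M" "g \<in> carrier G" "h \<in> carrier G"
  shows "orbit_dist d (orbit G \<phi> x) (orbit G \<phi> y) \<le> d (\<phi> g x) (\<phi> h y)"
proof -
  have "bdd_below {d a b |a b. a \<in> orbit G \<phi> x \<and> b \<in> orbit G \<phi> y}"
    by (rule bdd_belowI[of _ 0]) auto
  moreover have "\<phi> g x \<in> orbit G \<phi> x" "\<phi> h y \<in> orbit G \<phi> y"
    using assms by (auto simp: orbit_def)
  ultimately show ?thesis
    using assms orbit_nonempty by (auto simp: orbit_dist_def intro!: cInf_lower)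
qed

text \<open>The infimum over a finite nonempty set is a minimum.\<close>

lemma orbit_dist_attained:
  assumes "finite (carrier G)" "x \<in> M" "y \<in> M"
  obtains g where "g \<in> carrier G" "orbit_dist d (orbit G \<phi> x) (orbit G \<phi> y) = d x (\<phi> g y)"
proof -
  interpret grp: group G using group_hom group_hom.axioms(1) by auto
  have "(\<lambda>g. d x (\<phi> g y)) ` carrier G \<noteq> {}"
    using grp.one_closed by blast
  then have "(INF g\<in>carrier G. d x (\<phi> g y)) \<in> (\<lambda>g. d x (\<phi> g y)) ` carrier G"
    using assms(1) by (metis cInf_eq_Min finite_imageI Min_in)
  then show thesis using that assms by (auto simp: orbit_dist_eq)
qed

end


theorem theorem1:
  fixes G :: "('g, 'c) monoid_scheme"
    and X :: "'a set"
    and d :: "'a \<Rightarrow> 'a \<Rightarrow> real"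
    and \<phi> :: "'g \<Rightarrow> 'a \<Rightarrow> 'a"
  assumes "Metric_space X d"
    and "coarsely_embeds_into_Hilbert TYPE('v::real_vector) X d"
    and "finite (carrier G)"
    and "isometric_group_action G X \<phi> d"
  shows "coarsely_embeds_into_Hilbert TYPE('a set \<Rightarrow> real) (orbits G X \<phi>) (orbit_dist d)"
proof -
  interpret isometric_group_action G X \<phi> d by (fact assms(4))
  interpret grp: group G using group_hom group_hom.axioms(1) by auto
  obtain H :: "'v set" and ip f where "hilbert_space H ip"
    and f: "coarse_embedding X d H (ip_dist H ip) f"
    using assms(2) unfolding coarsely_embeds_into_Hilbert_def by blast
  interpret hilbert_space H ip by fact
  obtain \<rho>\<^sub>1 \<rho>\<^sub>2 :: "real \<Rightarrow> real" where fH: "f \<in> X \<rightarrow> H"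
    and \<rho>_nonneg: "\<rho>\<^sub>1 \<in> {0..} \<rightarrow> {0..}" "\<rho>\<^sub>2 \<in> {0..} \<rightarrow> {0..}"
    and \<rho>_mono: "mono_on {0..} \<rho>\<^sub>1" "mono_on {0..} \<rho>\<^sub>2"
    and \<rho>\<^sub>1_lim: "filterlim \<rho>\<^sub>1 at_top at_top"
    and \<rho>\<^sub>1: "\<And>x y. \<lbrakk>x \<in> X; y \<in> X\<rbrakk> \<Longrightarrow> \<rho>\<^sub>1 (d x y) \<le> ip_dist H ip (f x) (f y)"
    and \<rho>\<^sub>2: "\<And>x y. \<lbrakk>x \<in> X; y \<in> X\<rbrakk> \<Longrightarrow> ip_dist H ip (f x) (f y) \<le> \<rho>\<^sub>2 (d x y)"
    using f unfolding coarse_embedding_def by blast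

  \<comment> \<open>Gaussian kernels at all scales and their orbit sums\<close>
  define m where "m = real (card (carrier G))"
  have m: "1 \<le> m"
    using assms(3) grp.one_closed by (auto simp: m_def Suc_le_eq card_gt_0_iff)
  \<comment> \<open>Summability of the scales bounds the total by a multiple of
    \<open>\<rho>\<^sub>2\<close>, while having infinitely many of them lets more and more terms
    reach \<open>m\<close> as the distance grows.\<close>
  define \<tau> where "\<tau> n = (1 / 2 :: real) ^ n" for n
  have \<tau>: "0 < \<tau> n" for n by (simp add: \<tau>_def)
  define \<delta> where "\<delta> x y = ip_dist H ip (f x) (f y)" for x y
  define k where "k n x y = exp (- (\<tau> n * \<delta> x y)\<^sup>2)" for n x y
  define N where "N n = kernel_dist (orbit_kernel (k n))" for n
  define D where "D x y = orbit_dist d (orbit G \<phi> x) (orbit G \<phi> y)" for x y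
  have D_nonneg: "0 \<le> D x y" for x y
    unfolding D_def orbit_dist_def by (auto intro!: cInf_greatest)
  have k_sym: "k n x y = k n y x" for n x y
    by (simp add: k_def \<delta>_def metric.commute)
  have k_diag: "k n x x = 1" if "x \<in> X" for n x
    using that fH by (simp add: k_def \<delta>_def Pi_iff)
  have N_neg: "conditionally_negative X (N n)" for n
    unfolding N_def
  proof (rule conditionally_negative_kernel_dist, rule positive_semidefinite_orbit_kernel)
    fix F assume F: "finite F" "F \<subseteq> X"
    have "positive_semidefinite (F \<times> carrier G)
        (\<lambda>p q. exp (- (\<tau> n * ip_dist H ip (f (\<phi> (snd p) (fst p))) (f (\<phi> (snd q) (fst q))))\<^sup>2))"
      using F assms(3) fH
      by (intro positive_semidefinite_Gaussian) (auto simp: action_mem Pi_iff subset_iff)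
    then show "positive_semidefinite (F \<times> carrier G) (\<lambda>(x, g) (y, h). k n (\<phi> g x) (\<phi> h y))"
      by (simp add: k_def \<delta>_def split_def)
  qed
  have N_diag: "N n x x = 0" for n x
    by (simp add: N_def kernel_dist_def)
  have N_sym: "N n x y = N n y x" if "x \<in> X" "y \<in> X" for n x y
    using that orbit_kernel_commute[of "k n" x y] k_sym by (simp add: N_def kernel_dist_def)
  have N_nonneg: "0 \<le> N n x y" if "x \<in> X" "y \<in> X" for n x y
    using conditionally_negative_nonneg[OF N_neg that] N_diag N_sym that by simp

  \<comment> \<open>Estimates at a single scale\<close>
  have N_le: "N n x y \<le> 2 * m\<^sup>2 * \<rho>\<^sub>2 (D x y) * \<tau> n" if xy: "x \<in> X" "y \<in> X" for n x y
  proof -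
    obtain g0 where g0: "g0 \<in> carrier G" "D x y = d x (\<phi> g0 y)"
      using orbit_dist_attained[OF assms(3) xy] unfolding D_def by blast
    have "\<bar>k n a (\<phi> g x) - k n a (\<phi> g (\<phi> g0 y))\<bar> \<le> \<tau> n * \<rho>\<^sub>2 (D x y)"
      if ag: "a \<in> X" "g \<in> carrier G" for a g
    proof -
      \<comment> \<open>Both points are translates by the same \<open>g\<close>, so by isometry
        their distance is \<open>d x (\<phi> g0 y)\<close>, which is \<open>D x y\<close> whatever
        \<open>a\<close> and \<open>g\<close> are.\<close>
      define b c where "b = \<phi> g x" and "c = \<phi> g (\<phi> g0 y)"
      have bc: "b \<in> X" "c \<in> X" using xy g0 ag by (simp_all add: b_def c_def action_mem)
      have fabc: "f a \<in> H" "f b \<in> H" "f c \<in> H" using fH ag bc by auto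
      have "\<bar>k n a b - k n a c\<bar> \<le> \<bar>\<tau> n * \<delta> a b - \<tau> n * \<delta> a c\<bar>"
        unfolding k_def using \<tau>[of n] by (intro exp_minus_square_Lipschitz) (simp_all add: \<delta>_def)
      also have "\<dots> = \<tau> n * \<bar>\<delta> a b - \<delta> a c\<bar>"
        using \<tau>[of n] by (simp add: abs_mult flip: right_diff_distrib)
      also have "\<dots> \<le> \<tau> n * \<delta> b c"
        using \<tau>[of n] metric.triangle[of "f a" "f b" "f c"] metric.triangle[of "f a" "f c" "f b"] fabc
          metric.commute[of "f b" "f c"]
        by (intro mult_left_mono) (simp_all add: \<delta>_def abs_le_iff)
      also have "\<dots> \<le> \<tau> n * \<rho>\<^sub>2 (d b c)"
        using \<tau>[of n] \<rho>\<^sub>2[OF bc] by (simp add: \<delta>_def)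
      also have "d b c = D x y"
        using g0 xy ag by (simp add: b_def c_def isometry action_mem)
      finally show ?thesis by (simp add: b_def c_def)
    qed
    then show ?thesis
      using kernel_dist_orbit_kernel_le[of "k n" x y g0 "\<tau> n * \<rho>\<^sub>2 (D x y)"] xy g0 k_sym
      by (simp add: N_def m_def mult_ac)
  qed
  have \<tau>_sums: "\<tau> sums 2"
    using geometric_sums[of "1 / 2 :: real"] by (simp add: \<tau>_def [abs_def])
  have N_summable: "summable (\<lambda>n. N n x y)" if "x \<in> X" "y \<in> X" for x y
    using that N_le N_nonneg
    by (intro summable_comparison_test'[OF summable_mult[OF sums_summable[OF \<tau>_sums]]]) simp
  \<comment> \<open>The condition on the scale makes \<open>2 * orbit_kernel (k n) x y\<close> at
    most \<open>m\<close>, and both diagonal terms are at least \<open>m\<close>, which leaves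
    \<open>m + m - m\<close>.\<close>
  have N_ge: "m \<le> N n x y" if xy: "x \<in> X" "y \<in> X" and far: "2 * m \<le> \<tau> n * \<rho>\<^sub>1 (D x y)" for n x y
  proof -
    have "k n (\<phi> g x) (\<phi> h y) \<le> exp (- (\<tau> n * \<rho>\<^sub>1 (D x y))\<^sup>2)"
      if gh: "g \<in> carrier G" "h \<in> carrier G" for g h
    proof -
      have "\<rho>\<^sub>1 (D x y) \<le> \<rho>\<^sub>1 (d (\<phi> g x) (\<phi> h y))"
        using orbit_dist_le[OF xy gh] D_nonneg by (intro mono_onD[OF \<rho>_mono(1)]) (auto simp: D_def)
      also have "\<dots> \<le> \<delta> (\<phi> g x) (\<phi> h y)"
        unfolding \<delta>_def using xy gh by (intro \<rho>\<^sub>1 action_mem)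
      finally have "(\<tau> n * \<rho>\<^sub>1 (D x y))\<^sup>2 \<le> (\<tau> n * \<delta> (\<phi> g x) (\<phi> h y))\<^sup>2"
        using \<tau>[of n] funcset_mem[OF \<rho>_nonneg(1), of "D x y"] D_nonneg[of x y] by (intro power_mono mult_left_mono) auto
      then show ?thesis by (simp add: k_def)
    qed
    then have "orbit_kernel (k n) x y \<le> m\<^sup>2 * exp (- (\<tau> n * \<rho>\<^sub>1 (D x y))\<^sup>2)"
      unfolding m_def by (rule orbit_kernel_le)
    then have "2 * orbit_kernel (k n) x y \<le> m * (2 * m * exp (- (\<tau> n * \<rho>\<^sub>1 (D x y))\<^sup>2))"
      by (simp add: power2_eq_square mult_ac)
    also have "\<dots> \<le> m * 1"
      using m by (intro mult_left_mono exp_minus_square_le far) auto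
    finally have "2 * orbit_kernel (k n) x y \<le> m" by simp
    moreover have diag: "m \<le> orbit_kernel (k n) z z" if "z \<in> X" for z
      unfolding m_def using assms(3) k_diag that by (intro orbit_kernel_diag_ge) (auto simp: k_def)
    ultimately show ?thesis
      using diag[OF xy(1)] diag[OF xy(2)] by (simp add: N_def kernel_dist_def)
  qed

  \<comment> \<open>Control functions for the sum over all scales\<close>
  \<comment> \<open>With \<open>q = \<rho>\<^sub>1 r / (2 * m)\<close>, the scale \<open>n\<close>
    contributes at least \<open>m\<close> if \<open>2 ^ n \<le> q\<close>, and at least
    \<open>log 2 q\<close> scales satisfy this. The maximum with 1 gives the bound 0 when none does.
    The root is taken because the sum is a squared distance.\<close>
  define \<sigma>\<^sub>1 where "\<sigma>\<^sub>1 r = sqrt (m * log 2 (max 1 (\<rho>\<^sub>1 r / (2 * m))))" for r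
  \<comment> \<open>The constant 4 is the 2 of the bound at each scale times the sum 2 of all
    \<open>\<tau> n\<close>.\<close>
  define \<sigma>\<^sub>2 where "\<sigma>\<^sub>2 r = sqrt (4 * m\<^sup>2 * \<rho>\<^sub>2 r)" for r
  define N' where "N' x y = (\<Sum>n. N n x y)" for x y
  have upper: "sqrt (N' x y) \<le> \<sigma>\<^sub>2 (D x y)" if xy: "x \<in> X" "y \<in> X" for x y
  proof -
    have "N' x y \<le> 2 * m\<^sup>2 * \<rho>\<^sub>2 (D x y) * 2"
      unfolding N'_def using N_le[OF xy]
      by (intro sums_le[OF _ summable_sums[OF N_summable[OF xy]] sums_mult[OF \<tau>_sums]])
    then show ?thesis by (simp add: \<sigma>\<^sub>2_def)
  qed
  have lower: "\<sigma>\<^sub>1 (D x y) \<le> sqrt (N' x y)" if xy: "x \<in> X" "y \<in> X" for x y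
  proof -
    define q where "q = \<rho>\<^sub>1 (D x y) / (2 * m)"
    have "m * log 2 (max 1 q) \<le> N' x y"
    proof (cases "1 \<le> q")
      case False
      then show ?thesis
        using N_nonneg[OF xy] by (simp add: N'_def suminf_nonneg N_summable[OF xy])
    next
      case True
      \<comment> \<open>The scales from 0 to \<open>K\<close> all qualify. Counting 0 they are
        \<open>Suc K\<close> many, which makes up for rounding the logarithm down.\<close>
      define K where "K = nat \<lfloor>log 2 q\<rfloor>"
      have log_q: "0 \<le> log 2 q" using True by simp
      have "m \<le> N n x y" if "n < Suc K" for n
      proof (rule N_ge[OF xy])
        have "real n \<le> log 2 q" using that log_q by (simp add: K_def less_Suc_eq_le) linarith
        then have "2 ^ n \<le> q" using True by (simp add: le_log_iff powr_realpow)
        then show "2 * m \<le> \<tau> n * \<rho>\<^sub>1 (D x y)"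
          using m by (simp add: q_def \<tau>_def field_simps)
      qed
      then have "(\<Sum>n<Suc K. m) \<le> (\<Sum>n<Suc K. N n x y)"
        by (intro sum_mono) simp
      also have "\<dots> \<le> N' x y"
        unfolding N'_def using N_nonneg[OF xy] by (intro sum_le_suminf N_summable[OF xy]) auto
      finally have "m * real (Suc K) \<le> N' x y" by (simp add: mult.commute)
      moreover have "log 2 q \<le> real (Suc K)" using log_q by (simp add: K_def) linarith
      then have "m * log 2 q \<le> m * real (Suc K)" using m by (intro mult_left_mono) auto
      ultimately show ?thesis using True by (simp add: max_def)
    qed
    then show ?thesis by (simp add: \<sigma>\<^sub>1_def q_def)
  qed
  have \<sigma>_nonneg: "\<sigma>\<^sub>1 \<in> {0..} \<rightarrow> {0..}" "\<sigma>\<^sub>2 \<in> {0..} \<rightarrow> {0..}"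
    using m \<rho>_nonneg by (auto simp: Pi_iff \<sigma>\<^sub>1_def \<sigma>\<^sub>2_def)
  have "mono_on {0..} \<sigma>\<^sub>1"
  proof (rule mono_onI)
    fix r s :: real assume "r \<in> {0..}" "s \<in> {0..}" "r \<le> s"
    then have "\<rho>\<^sub>1 r / (2 * m) \<le> \<rho>\<^sub>1 s / (2 * m)"
      using m mono_onD[OF \<rho>_mono(1)] by (simp add: divide_right_mono)
    then show "\<sigma>\<^sub>1 r \<le> \<sigma>\<^sub>1 s"
      unfolding \<sigma>\<^sub>1_def using m
      by (intro real_sqrt_le_mono mult_left_mono log_mono max.mono) auto
  qed
  moreover have "mono_on {0..} \<sigma>\<^sub>2"
    using mono_onD[OF \<rho>_mono(2)] by (auto intro!: mono_onI mult_left_mono simp: \<sigma>\<^sub>2_def)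
  moreover have "filterlim \<sigma>\<^sub>1 at_top at_top"
  proof -
    \<comment> \<open>With \<open>\<rho>\<^sub>1 r\<close> replaced by a variable the expression is
      explicit, and its limit composes with that of \<open>\<rho>\<^sub>1\<close>.\<close>
    have "filterlim (\<lambda>t. sqrt (m * log 2 (max 1 (t / (2 * m))))) at_top at_top"
      using m by real_asymp
    then show ?thesis
      unfolding \<sigma>\<^sub>1_def by (rule filterlim_compose[OF _ \<rho>\<^sub>1_lim])
  qed
  ultimately have \<sigma>: "mono_on {0..} \<sigma>\<^sub>1" "mono_on {0..} \<sigma>\<^sub>2" "filterlim \<sigma>\<^sub>1 at_top at_top"
    by blast+

  \<comment> \<open>Embedding of the orbit space\<close>
  have "conditionally_negative X N'"
    unfolding N'_def using N_neg N_summable by (intro conditionally_negative_suminf)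
  moreover have "N' x x = 0" "N' x y = N' y x" if "x \<in> X" "y \<in> X" for x y
    using N_diag N_sym[OF that] by (simp_all add: N'_def)
  ultimately obtain K :: "((nat \<Rightarrow> 'a \<Rightarrow> real) \<Rightarrow> real) set" and jp e where K: "hilbert_space K jp"
    and e: "e \<in> X \<rightarrow> K" "\<And>x y. \<lbrakk>x \<in> X; y \<in> X\<rbrakk> \<Longrightarrow> ip_dist K jp (e x) (e y) = sqrt (N' x y)"
    using Schoenberg[of X N'] by metis
  \<comment> \<open>Any choice of representatives serves, because both control functions are
    evaluated at \<open>D\<close>, which depends only on the orbits.\<close>
  define rep where "rep A = (SOME x. x \<in> X \<and> A = orbit G \<phi> x)" for A
  have rep: "rep A \<in> X \<and> A = orbit G \<phi> (rep A)" if "A \<in> orbits G X \<phi>" for A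
    unfolding rep_def by (rule someI_ex) (use that in \<open>auto simp: orbits_def\<close>)
  have "ip_dist K jp (e (rep A)) (e (rep B)) = sqrt (N' (rep A) (rep B))"
    "orbit_dist d A B = D (rep A) (rep B)" if "A \<in> orbits G X \<phi>" "B \<in> orbits G X \<phi>" for A B
    using rep that e(2) by (auto simp: D_def)
  then have "coarse_embedding (orbits G X \<phi>) (orbit_dist d) K (ip_dist K jp) (\<lambda>A. e (rep A))"
    unfolding coarse_embedding_def
    using \<sigma>_nonneg \<sigma> rep e(1) lower upper
    by (intro conjI exI[of _ \<sigma>\<^sub>1] exI[of _ \<sigma>\<^sub>2]) auto
  \<comment> \<open>The Hilbert space from Schoenberg's theorem lies in another function type; the
    transfer lemma moves it into the real functions on \<open>'a set\<close>.\<close>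
  then show ?thesis
    using K by (intro coarsely_embeds_into_Hilbert_fun) (auto simp: coarsely_embeds_into_Hilbert_def)
qed

end
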